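(* Let $p\ge 1$. For every log-concave random variable $X$ (with respect to Lebesgue measure on $\mathbb{R}$), $$\frac{1}{2^p(p+1)}\le M^p(X)\,\sigma_p(X)\le\frac{\Gamma(1+p)}{e}+\int_0^1(1-x)^pe^{-x}\,dx .$$ The left-hand inequality holds for any real random variable $X$ with a density with respect to Lebesgue measure and finite mean (not necessarily log-concave), and holds with equality when $X$ is uniform on an interval; the right-hand inequality holds with equality when $X$ has an exponential distribution. Moreover, for every integer $n\ge 1$ and every log-concave $X$, $$M^n(X)\,\sigma_n(X)\le\frac{n!}{e}+(-1)^n\left(!n-\frac{n!}{e}\right).$$
   Context: A function $f:\mathbb{R}\to[0,\infty)$ is log-concave if $f((1-s)x+sy)\ge f(x)^{1-s}f(y)^s$ for all $x,y\in\mathbb{R}$, $s\in[0,1]$. A real random variable is log-concave (with respect to Lebesgue measure) if it has a Lebesgue density that is almost everywhere equal to a log-concave function. For a random variable $X$ with Lebesgue density $f$, $M(X)$ is the essential supremum of $f$ (possibly $+\infty$), and $M^p(X)=(M(X))^p$. For $X$ with finite expectation and $p\ge1$, $\sigma_p(X)=\mathbb{E}|X-\mathbb{E}[X]|^p\in[0,\infty]$. For an integer $n\ge1$, the subfactorial is $!n=\int_0^\infty(x-1)^ne^{-x}\,dx$. *)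

theory Defs
  imports "HOL-Probability.Probability"
begin

text \<open>For \<open>s = 0\<close> and \<open>s = 1\<close> the inequality is trivial for a nonnegative \<open>f\<close> whichever
  value \<open>0\<^sup>0\<close> is given, so Isabelle's \<open>0 powr 0 = 0\<close> does not matter here.\<close>

definition log_concave_fun :: "(real \<Rightarrow> real) \<Rightarrow> bool" where
  "log_concave_fun f \<longleftrightarrow>
     (\<forall>x. 0 \<le> f x) \<and>
     (\<forall>x y. \<forall>s\<in>{0..1}. f x powr (1 - s) * f y powr s \<le> f ((1 - s) * x + s * y))"

definition log_concave_rv :: "'a measure \<Rightarrow> ('a \<Rightarrow> real) \<Rightarrow> bool" where
  "log_concave_rv M X \<longleftrightarrow>
     (\<exists>f g. distributed M lborel X f \<and> log_concave_fun g \<and>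
            (AE x in lborel. f x = ennreal (g x)))"

text \<open>Only meaningful for exponents \<open>p > 0\<close>.\<close>

definition ennreal_powr :: "ennreal \<Rightarrow> real \<Rightarrow> ennreal" where
  "ennreal_powr x p = (if x = \<infinity> then \<infinity> else ennreal (enn2real x powr p))"

text \<open>\<open>M(X)\<close>, for \<open>X\<close> with a Lebesgue density. The Radon-Nikodym derivative is one version of the
  density; the lemma \<open>max_density_eq\<close> shows that every other version gives the same value.\<close>

definition max_density :: "'a measure \<Rightarrow> ('a \<Rightarrow> real) \<Rightarrow> ennreal" where
  "max_density M X = esssup lborel (RN_deriv lborel (distr M lborel X))"

lemma max_density_eq:
  assumes "distributed M lborel X f"
  shows "max_density M X = esssup lborel f"
proof -
  have f: "f \<in> borel_measurable lborel" and eq: "density lborel f = distr M lborel X"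
    using assms by (auto simp: distributed_def)
  have "AE x in lborel. f x = RN_deriv lborel (distr M lborel X) x"
    by (rule sigma_finite_measure.RN_deriv_unique[OF sigma_finite_lborel f eq])
  then have "AE x in lborel. RN_deriv lborel (distr M lborel X) x = f x"
    by (rule AE_mp) auto
  then show ?thesis
    unfolding max_density_def using f by (intro esssup_AE_cong) auto
qed

text \<open>\<open>\<sigma>\<^sub>p(X)\<close>, for \<open>X\<close> with finite expectation; it may be \<open>\<infinity>\<close>.\<close>

definition central_abs_moment :: "'a measure \<Rightarrow> real \<Rightarrow> ('a \<Rightarrow> real) \<Rightarrow> ennreal" where
  "central_abs_moment M p X =
     (\<integral>\<^sup>+ \<omega>. ennreal (\<bar>X \<omega> - prob_space.expectation M X\<bar> powr p) \<partial>M)"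

definition subfactorial :: "nat \<Rightarrow> real" where
  "subfactorial n = (LBINT x:{0..}. (x - 1) ^ n * exp (- x))"

end

theory Submission
  imports Defs
begin

text \<open>
  The product \<open>M\<^sup>p(X) \<sigma>\<^sub>p(X)\<close> does not change when \<open>X\<close> is replaced by \<open>K (X - m)\<close> with
  \<open>K > 0\<close>, so a log-concave density \<open>g\<close> may be normalised to have its maximum, of value \<open>1\<close>,
  at \<open>0\<close> (\<open>log_concave_fun_attains_max\<close>). The upper bound then comes from two comparisons.

  Let \<open>A\<close> and \<open>B\<close> be the masses of \<open>g\<close> to the right and to the left of \<open>0\<close>, and let \<open>Y\<close> have the
  two-sided exponential density \<open>e\<^bsup>-x/A\<^esup>\<close> for \<open>x > 0\<close> and \<open>e\<^bsup>x/B\<^esup>\<close> for \<open>x < 0\<close>. It has the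
  same two masses and the same height at \<open>0\<close>, but its logarithm is affine on each side, so that
  among all log-concave densities with these data it is the most spread out. Precisely, shift
  \<open>X\<close> so that it has the mean \<open>A - B\<close> of \<open>Y\<close>. Since the points where a concave function
  exceeds an affine one form an interval, the two distribution functions cross at most once
  (\<open>log_concave_cdf_crosses_two_sided_exp\<close>). Equal means and a single crossing of the
  distribution functions give \<open>\<E> \<phi>(X - \<E> X) \<le> \<E> \<phi>(Y - \<E> Y)\<close> for every convex
  \<open>\<phi> \<ge> 0\<close> (\<open>convex_order_of_cdf_crossing\<close>, \<open>convex_order_two_sided_exp\<close>).

  What remains is a family with one parameter, as \<open>A + B = 1\<close>. Here a stronger
  comparison holds: \<open>\<bar>Y - \<E> Y\<bar>\<close> is stochastically dominated by \<open>\<bar>E - 1\<bar>\<close>, where \<open>E\<close> is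
  standard exponential (\<open>two_sided_exp_deviation_le\<close>). This is an explicit inequality between
  exponential functions (\<open>two_sided_exp_cdf_central_ge\<close>). The upper bound is the moment
  \<open>\<E> \<bar>E - 1\<bar>\<^sup>p\<close>, which splits at \<open>1\<close> into the integral over \<open>[0, 1]\<close> and
  \<open>\<Gamma>(1 + p) / e\<close>; for an integer \<open>p\<close> the same splitting of the subfactorial gives the last
  inequality.

  The lower bound is the bathtub principle (\<open>central_moment_max_density_ge\<close>): among densities
  bounded by \<open>d\<close>, the one with the smallest moment about \<open>c\<close> is equal to \<open>d\<close> on the interval
  of length \<open>1 / d\<close> with centre \<open>c\<close>.
\<close>

section \<open>Comparison of real distributions through quantiles\<close>

lemma real_distributionI:
  assumes "prob_space M" "sets M = sets borel"
  shows "real_distribution M"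
  using assms by (simp add: real_distribution_def real_distribution_axioms_def)

lemma (in cdf_distribution) nn_integral_quantile:
  assumes [measurable]: "h \<in> borel_measurable borel"
  shows "(\<integral>\<^sup>+x. h x \<partial>M) = (\<integral>\<^sup>+\<omega>. h (I \<omega>) \<partial>restrict_space lborel {0<..<1})"
  by (subst distr_I_eq_M[symmetric], subst nn_integral_distr) auto

lemma (in cdf_distribution) integral_quantile:
  assumes "integrable M (\<lambda>x. x)"
  shows "integrable (restrict_space lborel {0<..<1}) I"
    and "(\<integral>\<omega>. I \<omega> \<partial>restrict_space lborel {0<..<1}) = (\<integral>x. x \<partial>M)"
proof -
  have I: "I \<in> borel_measurable (restrict_space lborel {0<..<1})"
    using measurable_CI by simp
  have "integrable (distr (restrict_space lborel {0<..<1}) borel I) (\<lambda>x. x)"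
    using assms by (subst distr_I_eq_M)
  then show "integrable (restrict_space lborel {0<..<1}) I"
    using I by (subst (asm) integrable_distr_eq) auto
  show "(\<integral>\<omega>. I \<omega> \<partial>restrict_space lborel {0<..<1}) = (\<integral>x. x \<partial>M)"
    using integral_distr[OF I, of "\<lambda>x. x"] by (simp add: distr_I_eq_M)
qed

text \<open>The infimum is the quantile function of the distribution. Under Lebesgue measure on \<open>(0, 1)\<close> it
has the given law, so two laws can be compared by comparing their quantile functions pointwise.\<close>

lemma quantile_mono:
  assumes "cdf_distribution M" "cdf_distribution N"
    and le: "\<And>x. cdf N x \<le> cdf M x" and \<omega>: "\<omega> \<in> {0<..<1}"
  shows "Inf {x. \<omega> \<le> cdf M x} \<le> Inf {x. \<omega> \<le> cdf N x}"
proof -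
  interpret M: cdf_distribution M by fact
  interpret N: cdf_distribution N by fact
  have "\<omega> \<le> cdf N (Inf {x. \<omega> \<le> cdf N x})"
    using N.pseudoinverse[of \<omega> "Inf {x. \<omega> \<le> cdf N x}"] \<omega> by simp
  also have "\<dots> \<le> cdf M (Inf {x. \<omega> \<le> cdf N x})" by (rule le)
  finally show ?thesis using M.pseudoinverse[of \<omega> "Inf {x. \<omega> \<le> cdf N x}"] \<omega> by simp
qed

lemma nn_integral_mono_stochastic_order:
  fixes h :: "real \<Rightarrow> ennreal"
  assumes M: "real_distribution M" and N: "real_distribution N"
    and le: "\<And>x. cdf N x \<le> cdf M x"
    and h: "mono h" "h \<in> borel_measurable borel"
  shows "(\<integral>\<^sup>+x. h x \<partial>M) \<le> (\<integral>\<^sup>+x. h x \<partial>N)"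
proof -
  interpret M: cdf_distribution M using M by (simp add: cdf_distribution_def)
  interpret N: cdf_distribution N using N by (simp add: cdf_distribution_def)
  have "(\<integral>\<^sup>+\<omega>. h (M.I \<omega>) \<partial>restrict_space lborel {0<..<1}) \<le> (\<integral>\<^sup>+\<omega>. h (N.I \<omega>) \<partial>restrict_space lborel {0<..<1})"
  proof (rule nn_integral_mono)
    fix \<omega> :: real
    assume "\<omega> \<in> space (restrict_space lborel {0<..<1})"
    then have "\<omega> \<in> {0<..<1}" by (simp add: space_restrict_space)
    then have "M.I \<omega> \<le> N.I \<omega>"
      by (rule quantile_mono[OF M.cdf_distribution_axioms N.cdf_distribution_axioms le])
    then show "h (M.I \<omega>) \<le> h (N.I \<omega>)"
      by (rule monoD[OF h(1)])
  qed
  then show ?thesis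
    by (simp only: M.nn_integral_quantile[OF h(2)] N.nn_integral_quantile[OF h(2)])
qed

text \<open>The slopes of a convex function are monotone. Therefore the bound that a subgradient \<open>k\<close> at \<open>x0\<close>
gives for the increments from \<open>x0\<close> persists for increments from any \<open>x\<close> to a point \<open>y\<close> that
lies beyond \<open>x\<close> as seen from \<open>x0\<close>.\<close>

lemma convex_on_subgradient_beyond:
  fixes \<phi> :: "real \<Rightarrow> real"
  assumes cvx: "convex_on UNIV \<phi>" and k: "\<And>z. \<phi> x0 + k * (z - x0) \<le> \<phi> z"
    and away: "x0 \<le> x \<and> x \<le> y \<or> y \<le> x \<and> x \<le> x0"
  shows "\<phi> x + k * (y - x) \<le> \<phi> y"
proof (cases "y = x0")
  case True
  then have "x = y" using away by auto
  then show ?thesis by simp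
next
  case False
  define t where "t = (x - x0) / (y - x0)"
  have t: "0 \<le> t" "t \<le> 1"
    using away False unfolding t_def by (auto simp: divide_simps)
  have "t * (y - x0) = x - x0" using False by (simp add: t_def)
  then have x: "(1 - t) * x0 + t * y = x" and d: "y - x = (1 - t) * (y - x0)"
    by (simp_all add: algebra_simps)
  have "\<phi> x \<le> (1 - t) * \<phi> x0 + t * \<phi> y"
    using convex_onD[OF cvx, of t x0 y] t unfolding real_scaleR_def x by simp
  moreover have "(1 - t) * (\<phi> x0 + k * (y - x0)) \<le> (1 - t) * \<phi> y"
    using k t by (intro mult_left_mono) auto
  moreover have "k * (y - x) = (1 - t) * (k * (y - x0))"
    unfolding d by simp
  ultimately show ?thesis by (simp add: algebra_simps)
qed

text \<open>If the distribution functions cross at \<open>x0\<close>, the quantile function of \<open>N\<close> lies beyond that of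
\<open>M\<close>, as seen from \<open>x0\<close>. A single subgradient \<open>k\<close> of \<open>\<phi>\<close> at \<open>x0\<close> then bounds the gain
of \<open>\<phi>\<close> from below by \<open>k\<close> times the difference of the quantiles, at every level; and this
difference integrates to zero because the means agree.\<close>

lemma convex_order_of_cdf_crossing:
  fixes \<phi> :: "real \<Rightarrow> real"
  assumes M: "real_distribution M" and N: "real_distribution N"
    and int: "integrable M (\<lambda>x. x)" "integrable N (\<lambda>x. x)"
    and mean: "(\<integral>x. x \<partial>M) = (\<integral>x. x \<partial>N)"
    and cross: "\<And>x y. x < y \<Longrightarrow> cdf N x < cdf M x \<Longrightarrow> cdf N y \<le> cdf M y"
    and cvx: "convex_on UNIV \<phi>" and nonneg: "\<And>x. 0 \<le> \<phi> x"
  shows "(\<integral>\<^sup>+x. ennreal (\<phi> x) \<partial>M) \<le> (\<integral>\<^sup>+x. ennreal (\<phi> x) \<partial>N)"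
proof -
  interpret M: cdf_distribution M using M by (simp add: cdf_distribution_def)
  interpret N: cdf_distribution N using N by (simp add: cdf_distribution_def)
  let ?\<Omega> = "restrict_space lborel {0<..<1} :: real measure"
  have [measurable]: "\<phi> \<in> borel_measurable borel"
    using convex_on_continuous[OF open_UNIV cvx] by (rule borel_measurable_continuous_onI)
  have m: "(\<lambda>x. ennreal (\<phi> x)) \<in> borel_measurable borel" by simp
  note iM = M.integral_quantile[OF int(1)] and iN = N.integral_quantile[OF int(2)]
  have meas[measurable]: "M.I \<in> borel_measurable ?\<Omega>" "N.I \<in> borel_measurable ?\<Omega>"
    using iM(1) iN(1) by auto
  have "\<exists>k. AE \<omega> in ?\<Omega>. \<phi> (M.I \<omega>) + k * (N.I \<omega> - M.I \<omega>) \<le> \<phi> (N.I \<omega>)"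
  proof (cases "(\<forall>x. cdf N x \<le> cdf M x) \<or> (\<forall>x. cdf M x \<le> cdf N x)")
    case True
    \<comment> \<open>Without a crossing the quantiles are ordered, and equal means force them to coincide.\<close>
    have "AE \<omega> in ?\<Omega>. N.I \<omega> - M.I \<omega> = 0"
      using True
    proof
      assume "\<forall>x. cdf N x \<le> cdf M x"
      then have "AE \<omega> in ?\<Omega>. 0 \<le> N.I \<omega> - M.I \<omega>"
        using quantile_mono[OF M.cdf_distribution_axioms N.cdf_distribution_axioms]
        by (intro AE_I2) (auto simp: space_restrict_space)
      then show ?thesis
        using iM iN mean integral_nonneg_eq_0_iff_AE[of ?\<Omega> "\<lambda>\<omega>. N.I \<omega> - M.I \<omega>"]
        by simp
    next
      assume "\<forall>x. cdf M x \<le> cdf N x"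
      then have "AE \<omega> in ?\<Omega>. 0 \<le> M.I \<omega> - N.I \<omega>"
        using quantile_mono[OF N.cdf_distribution_axioms M.cdf_distribution_axioms]
        by (intro AE_I2) (auto simp: space_restrict_space)
      then have "AE \<omega> in ?\<Omega>. M.I \<omega> - N.I \<omega> = 0"
        using iM iN mean integral_nonneg_eq_0_iff_AE[of ?\<Omega> "\<lambda>\<omega>. M.I \<omega> - N.I \<omega>"]
        by simp
      then show ?thesis by eventually_elim simp
    qed
    then have "AE \<omega> in ?\<Omega>. \<phi> (M.I \<omega>) + 0 * (N.I \<omega> - M.I \<omega>) \<le> \<phi> (N.I \<omega>)"
      by eventually_elim simp
    then show ?thesis by blast
  next
    case False
    define T where "T = {x. cdf N x < cdf M x}"
    obtain a b where a: "cdf M a < cdf N a" and b: "b \<in> T"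
      using False by (auto simp: T_def not_le)
    have aT: "a \<le> x" if "x \<in> T" for x
      using cross[of x a] that a by (force simp: T_def)
    then have bdd: "bdd_below T" unfolding bdd_below_def by blast
    define x0 where "x0 = Inf T"
    have below: "cdf M x \<le> cdf N x" if "x < x0" for x
      using cInf_lower[OF _ bdd, of x] that by (fastforce simp: T_def x0_def)
    have above: "cdf N x \<le> cdf M x" if "x0 < x" for x
    proof -
      obtain z where "z \<in> T" "z < x"
        using \<open>x0 < x\<close> b unfolding x0_def by (subst (asm) cInf_less_iff[OF _ bdd]) auto
      then show ?thesis using cross[of z x] by (auto simp: T_def)
    qed
    define k where "k = Inf ((\<lambda>t. (\<phi> x0 - \<phi> t) / (x0 - t)) ` ({x0<..} \<inter> UNIV))"
    have k: "\<phi> x0 + k * (z - x0) \<le> \<phi> z" for z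
      using convex_le_Inf_differential[OF cvx, of x0 z] by (simp add: k_def)
    have "\<phi> (M.I \<omega>) + k * (N.I \<omega> - M.I \<omega>) \<le> \<phi> (N.I \<omega>)" if \<omega>: "\<omega> \<in> {0<..<1}" for \<omega>
    proof -
      have PM: "\<omega> \<le> cdf M x \<longleftrightarrow> M.I \<omega> \<le> x" and PN: "\<omega> \<le> cdf N x \<longleftrightarrow> N.I \<omega> \<le> x" for x
        using M.pseudoinverse[of \<omega> x] N.pseudoinverse[of \<omega> x] \<omega> by auto
      consider "M.I \<omega> < x0" | "M.I \<omega> = x0" | "M.I \<omega> > x0" by linarith
      then show ?thesis
      proof cases
        case 1
        then have "N.I \<omega> \<le> M.I \<omega>"
          using below[of "M.I \<omega>"] PM[of "M.I \<omega>"] PN[of "M.I \<omega>"] by auto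
        with 1 show ?thesis by (intro convex_on_subgradient_beyond[OF cvx k]) auto
      next
        case 2
        with k show ?thesis by simp
      next
        case 3
        have "x \<le> N.I \<omega>" if "x0 < x" "x < M.I \<omega>" for x
          using above[OF that(1)] that(2) PM[of x] PN[of x] by linarith
        then have "M.I \<omega> \<le> N.I \<omega>"
          by (intro dense_le_bounded[OF 3]) auto
        with 3 show ?thesis by (intro convex_on_subgradient_beyond[OF cvx k]) auto
      qed
    qed
    then have "AE \<omega> in ?\<Omega>. \<phi> (M.I \<omega>) + k * (N.I \<omega> - M.I \<omega>) \<le> \<phi> (N.I \<omega>)"
      by (intro AE_I2) (auto simp: space_restrict_space)
    then show ?thesis by blast
  qed
  then obtain k where k: "AE \<omega> in ?\<Omega>. \<phi> (M.I \<omega>) \<le> \<phi> (N.I \<omega>) - k * (N.I \<omega> - M.I \<omega>)"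
    by (auto simp: algebra_simps)
  have "(\<integral>\<^sup>+\<omega>. ennreal (\<phi> (M.I \<omega>)) \<partial>?\<Omega>) \<le> (\<integral>\<^sup>+\<omega>. ennreal (\<phi> (N.I \<omega>)) \<partial>?\<Omega>)"
  proof (cases "(\<integral>\<^sup>+\<omega>. ennreal (\<phi> (N.I \<omega>)) \<partial>?\<Omega>) = \<infinity>")
    case False
    then have intN: "integrable ?\<Omega> (\<lambda>\<omega>. \<phi> (N.I \<omega>))"
      using nonneg by (intro integrableI_nonneg) (auto simp: less_top)
    have int: "integrable ?\<Omega> (\<lambda>\<omega>. \<phi> (N.I \<omega>) - k * (N.I \<omega> - M.I \<omega>))"
      using intN iM iN by (intro Bochner_Integration.integrable_diff integrable_mult_right) auto
    have "(\<integral>\<^sup>+\<omega>. ennreal (\<phi> (M.I \<omega>)) \<partial>?\<Omega>) \<le> (\<integral>\<^sup>+\<omega>. ennreal (\<phi> (N.I \<omega>) - k * (N.I \<omega> - M.I \<omega>)) \<partial>?\<Omega>)"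
      using k by (intro nn_integral_mono_AE) (auto elim!: eventually_mono intro: ennreal_leI)
    also have "\<dots> = ennreal (\<integral>\<omega>. \<phi> (N.I \<omega>) - k * (N.I \<omega> - M.I \<omega>) \<partial>?\<Omega>)"
    proof (rule nn_integral_eq_integral[OF int])
      show "AE \<omega> in ?\<Omega>. 0 \<le> \<phi> (N.I \<omega>) - k * (N.I \<omega> - M.I \<omega>)"
        using k by (rule eventually_mono) (rule order_trans[OF nonneg])
    qed
    also have "(\<integral>\<omega>. \<phi> (N.I \<omega>) - k * (N.I \<omega> - M.I \<omega>) \<partial>?\<Omega>) = (\<integral>\<omega>. \<phi> (N.I \<omega>) \<partial>?\<Omega>)"
      using intN iM iN mean by simp
    also have "ennreal \<dots> = (\<integral>\<^sup>+\<omega>. ennreal (\<phi> (N.I \<omega>)) \<partial>?\<Omega>)"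
      using nonneg by (intro nn_integral_eq_integral[symmetric] intN) auto
    finally show ?thesis .
  qed simp
  then show ?thesis
    by (simp only: M.nn_integral_quantile[OF m] N.nn_integral_quantile[OF m])
qed

section \<open>Log-concave functions on the line\<close>

lemma log_concave_fun_nonneg: "log_concave_fun g \<Longrightarrow> 0 \<le> g x"
  by (simp add: log_concave_fun_def)

lemma log_concave_funD:
  assumes "log_concave_fun g" "0 \<le> s" "s \<le> 1"
  shows "g x powr (1 - s) * g y powr s \<le> g ((1 - s) * x + s * y)"
  using assms by (simp add: log_concave_fun_def)

lemma log_concave_fun_min_le:
  assumes g: "log_concave_fun g" and z: "x \<le> z" "z \<le> y"
  shows "min (g x) (g y) \<le> g z"
proof (cases "x < y")
  case True
  define s where "s = (z - x) / (y - x)"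
  have s: "0 \<le> s" "s \<le> 1" using z True by (auto simp: s_def divide_simps)
  have "s * (y - x) = z - x" using True by (simp add: s_def)
  then have zeq: "(1 - s) * x + s * y = z" by (simp add: algebra_simps)
  define k where "k = min (g x) (g y)"
  have k: "0 \<le> k" "k \<le> g x" "k \<le> g y"
    using g by (auto simp: k_def log_concave_fun_nonneg)
  have "k = k powr (1 - s) * k powr s"
    using k(1) by (cases "k = 0") (auto simp flip: powr_add)
  also have "\<dots> \<le> g x powr (1 - s) * g y powr s"
    using k s by (intro mult_mono powr_mono2) auto
  also have "\<dots> \<le> g z"
    using log_concave_funD[OF g s, of x y] by (simp add: zeq)
  finally show ?thesis by (simp add: k_def)
next
  case False
  with z have "z = x" by auto
  then show ?thesis by simp
qed

lemma log_concave_fun_measurable: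
  assumes g: "log_concave_fun g"
  shows "g \<in> borel_measurable borel"
proof (rule borel_measurableI_greater)
  fix a :: real
  have "is_interval {x. a < g x}"
    unfolding is_interval_1
  proof safe
    fix x y z assume "a < g x" "a < g y" "x \<le> z" "z \<le> y"
    then show "a < g z" using log_concave_fun_min_le[OF g, of x z y] by auto
  qed
  then show "{x \<in> space borel. a < g x} \<in> sets borel"
    using real_interval_borel_measurable by simp
qed

text \<open>The function is at least \<open>k\<close> on the whole interval between \<open>x\<close> and \<open>y\<close>, which thus carries
mass at least \<open>k\<close> times its length.\<close>

lemma log_concave_fun_superlevel_length:
  assumes g: "log_concave_fun g" and int: "(\<integral>\<^sup>+x. ennreal (g x) \<partial>lborel) = 1"
    and k: "0 \<le> k" "k \<le> g x" "k \<le> g y"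
  shows "\<bar>y - x\<bar> * k \<le> 1"
proof -
  have *: "(y - x) * k \<le> 1" if "k \<le> g x" "k \<le> g y" "x \<le> y" for x y
  proof -
    have "k \<le> g z" if "x \<le> z" "z \<le> y" for z
      using log_concave_fun_min_le[OF g that] \<open>k \<le> g x\<close> \<open>k \<le> g y\<close> by auto
    then have "(\<integral>\<^sup>+z. ennreal k * indicator {x..y} z \<partial>lborel) \<le> (\<integral>\<^sup>+z. ennreal (g z) \<partial>lborel)"
      by (intro nn_integral_mono) (auto simp: indicator_def intro: ennreal_leI)
    then have "ennreal (k * (y - x)) \<le> ennreal 1"
      using \<open>x \<le> y\<close> k(1) by (simp add: nn_integral_cmult_indicator int ennreal_mult)
    then show ?thesis by (subst (asm) ennreal_le_iff) (auto simp: mult.commute)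
  qed
  from *[of x y] *[of y x] k show ?thesis by (cases "x \<le> y") auto
qed

text \<open>Fix \<open>a < b\<close> where \<open>g\<close> is at least \<open>k > 0\<close>. From a point \<open>x\<close> with a large value, half of the
way to the farther of \<open>a\<close> and \<open>b\<close> lies in the superlevel set of \<open>sqrt (g x * k)\<close>. As
this half is at least \<open>(b - a) / 4\<close> long, the unit mass bounds \<open>g x\<close>.\<close>

lemma log_concave_fun_bdd_above:
  assumes g: "log_concave_fun g" and int: "(\<integral>\<^sup>+x. ennreal (g x) \<partial>lborel) = 1"
  shows "bdd_above (range g)"
proof -
  have "\<exists>a b. a < b \<and> 0 < g a \<and> 0 < g b"
  proof (rule ccontr)
    assume no: "\<not> ?thesis"
    obtain a where a: "\<And>x. x \<noteq> a \<Longrightarrow> g x = 0"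
    proof (cases "\<exists>a. 0 < g a")
      case True
      then obtain a where "0 < g a" ..
      with no have "g x = 0" if "x \<noteq> a" for x
        using that log_concave_fun_nonneg[OF g, of x] by (metis linorder_neqE_linordered_idom order_le_less)
      then show ?thesis using that by blast
    next
      case False
      then show ?thesis
        using that log_concave_fun_nonneg[OF g] by (metis order_le_less)
    qed
    have "AE x in lborel. ennreal (g x) = 0"
      using AE_lborel_singleton[of a] by eventually_elim (simp add: a)
    then have "(\<integral>\<^sup>+x. ennreal (g x) \<partial>lborel) = (\<integral>\<^sup>+x. 0 \<partial>(lborel::real measure))"
      by (rule nn_integral_cong_AE)
    with int show False by simp
  qed
  then obtain a b where ab: "a < b" "0 < g a" "0 < g b" by blast
  define k where "k = min (g a) (g b)"
  have k: "0 < k" "k \<le> g a" "k \<le> g b" using ab by (auto simp: k_def)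
  have "g x \<le> max k (16 / ((b - a)\<^sup>2 * k))" for x
  proof (cases "g x \<le> k")
    case False
    obtain c where c: "k \<le> g c" "(b - a) / 2 \<le> \<bar>x - c\<bar>"
    proof (cases "(b - a) / 2 \<le> \<bar>x - a\<bar>")
      case True then show ?thesis using that k by blast
    next
      case False
      then have "(b - a) / 2 \<le> \<bar>x - b\<bar>" by (auto simp: abs_if field_simps split: if_splits)
      then show ?thesis using that k by blast
    qed
    define r where "r = sqrt (g x * k)"
    have r0: "0 \<le> r" using False k by (simp add: r_def)
    have rx: "r \<le> g x"
    proof -
      have "g x * k \<le> g x * g x" using False k by (intro mult_left_mono) auto
      then have "r \<le> sqrt (g x * g x)" unfolding r_def by (rule real_sqrt_le_mono)
      then show ?thesis using False k by simp
    qed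
    have "r \<le> g ((x + c) / 2)"
    proof -
      have "r \<le> sqrt (g x * g c)"
        unfolding r_def using c False k by simp
      also have "\<dots> = g x powr (1 - 1/2) * g c powr (1/2)"
        using False k c by (simp add: powr_half_sqrt real_sqrt_mult)
      also have "\<dots> \<le> g ((1 - 1/2) * x + 1/2 * c)"
        by (rule log_concave_funD[OF g]) auto
      finally show ?thesis by (simp add: field_simps)
    qed
    from log_concave_fun_superlevel_length[OF g int r0 rx this]
    have "\<bar>x - c\<bar> / 2 * r \<le> 1" by (simp add: abs_if field_simps split: if_splits)
    moreover have "(b - a) / 4 * r \<le> \<bar>x - c\<bar> / 2 * r"
      using c r0 by (intro mult_right_mono) auto
    ultimately have "(b - a) / 4 * r \<le> 1" by linarith
    then have "((b - a) / 4 * r)\<^sup>2 \<le> 1"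
      using ab r0 by (simp add: abs_square_le_1 del: times_divide_eq_left)
    moreover have "((b - a) / 4 * r)\<^sup>2 = (b - a)\<^sup>2 / 16 * (g x * k)"
      using False k by (simp add: r_def power_mult_distrib power_divide)
    ultimately have "g x \<le> 16 / ((b - a)\<^sup>2 * k)"
      using ab k by (simp add: field_simps)
    then show ?thesis by simp
  qed simp
  then show ?thesis by (rule bdd_aboveI2)
qed

text \<open>The defining inequality survives when the value of \<open>g\<close> at one end is replaced by a limit
of values nearby. It is applied with \<open>v n\<close> in place of \<open>m\<close> and with the weight \<open>t n\<close> that keeps
the intermediate point fixed.\<close>

lemma log_concave_fun_limit_point:
  assumes g: "log_concave_fun g" and v: "v \<longlonglongrightarrow> m" "(\<lambda>n. g (v n)) \<longlonglongrightarrow> K" and K: "0 < K"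
    and s: "0 < s" "s < 1" and "y \<noteq> m"
  shows "K powr (1 - s) * g y powr s \<le> g ((1 - s) * m + s * y)"
proof (cases "g y = 0")
  case True
  then show ?thesis using log_concave_fun_nonneg[OF g] by simp
next
  case False
  define z where "z = (1 - s) * m + s * y"
  define t where "t n = (z - y) / (v n - y)" for n
  have zy: "z - y = (1 - s) * (m - y)" by (simp add: z_def algebra_simps)
  have "t \<longlonglongrightarrow> (z - y) / (m - y)"
    unfolding t_def using \<open>y \<noteq> m\<close> by (intro tendsto_intros v) auto
  also have "(z - y) / (m - y) = 1 - s" using \<open>y \<noteq> m\<close> by (simp add: zy)
  finally have t: "t \<longlonglongrightarrow> 1 - s" .
  have "\<forall>\<^sub>F n in sequentially. v n \<noteq> y"
    using tendsto_imp_eventually_ne[OF v(1)] \<open>y \<noteq> m\<close> by auto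
  moreover have "\<forall>\<^sub>F n in sequentially. 0 < t n" "\<forall>\<^sub>F n in sequentially. t n < 1"
    using order_tendstoD[OF t] s by auto
  ultimately have ev: "\<forall>\<^sub>F n in sequentially. g (v n) powr t n * g y powr (1 - t n) \<le> g z"
  proof eventually_elim
    case (elim n)
    have "t n * (v n - y) = z - y" using elim by (simp add: t_def)
    then have "(1 - (1 - t n)) * v n + (1 - t n) * y = z" by (simp add: algebra_simps)
    then show ?case using log_concave_funD[OF g, of "1 - t n" "v n" y] elim by simp
  qed
  have "(\<lambda>n. g (v n) powr t n * g y powr (1 - t n)) \<longlonglongrightarrow> K powr (1 - s) * g y powr (1 - (1 - s))"
    using K False by (intro tendsto_intros v t) auto
  from tendsto_upperbound[OF this ev] show ?thesis by (simp add: z_def)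
qed

text \<open>The supremum \<open>K\<close> of a log-concave density need not be attained: \<open>exp (- x)\<close> on the
open half-line is an example. It is approached along a sequence in a superlevel set, which is
bounded, so the sequence accumulates at some \<open>m\<close>; raising the value at \<open>m\<close> to
\<open>K\<close> preserves log-concavity.\<close>

lemma log_concave_fun_attains_max:
  assumes g: "log_concave_fun g" and int: "(\<integral>\<^sup>+x. ennreal (g x) \<partial>lborel) = 1"
  obtains m K where "0 < K" "log_concave_fun (g(m := K))" "\<And>x. (g(m := K)) x \<le> K"
proof -
  note bdd = log_concave_fun_bdd_above[OF assms]
  define K where "K = Sup (range g)"
  have le: "g x \<le> K" for x unfolding K_def by (rule cSup_upper) (use bdd in auto)
  have "0 < K"
  proof (rule ccontr)
    assume "\<not> 0 < K"
    then have "g x = 0" for x using le[of x] log_concave_fun_nonneg[OF g, of x] by linarith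
    with int show False by simp
  qed
  have "\<exists>x. K - K / real (n + 2) < g x" for n
    using less_cSup_iff[OF _ bdd, of "K - K / real (n + 2)"] \<open>0 < K\<close> by (auto simp: K_def[symmetric])
  then obtain u where u: "\<And>n. K - K / real (n + 2) < g (u n)" by metis
  have half: "K / 2 \<le> g (u n)" for n
  proof -
    have "K / real (n + 2) \<le> K / 2" using \<open>0 < K\<close> by (intro divide_left_mono) auto
    then show ?thesis using u[of n] by linarith
  qed
  have "u n \<in> cball (u 0) (2 / K)" for n
    using log_concave_fun_superlevel_length[OF g int, of "K / 2" "u 0" "u n"] half[of 0] half[of n] \<open>0 < K\<close>
    by (simp add: dist_real_def field_simps abs_minus_commute)
  then obtain m r where r: "strict_mono r" "(u \<circ> r) \<longlonglongrightarrow> m"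
    using compact_cball[of "u 0" "2 / K"] unfolding compact_def by metis
  have gu: "(\<lambda>n. g (u n)) \<longlonglongrightarrow> K"
  proof (rule tendsto_sandwich)
    have "(\<lambda>n. K - K / real (n + 2)) \<longlonglongrightarrow> K - 0"
      by (intro tendsto_diff tendsto_const LIMSEQ_ignore_initial_segment lim_const_over_n)
    then show "(\<lambda>n. K - K / real (n + 2)) \<longlonglongrightarrow> K" by simp
    show "\<forall>\<^sub>F n in sequentially. K - K / real (n + 2) \<le> g (u n)"
      by (intro always_eventually allI less_imp_le u)
  qed (use le in auto)
  have gv: "(\<lambda>n. g ((u \<circ> r) n)) \<longlonglongrightarrow> K"
    using LIMSEQ_subseq_LIMSEQ[OF gu r(1)] by (simp add: o_def)
  note lim = log_concave_fun_limit_point[OF g r(2) gv \<open>0 < K\<close>]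
  let ?g = "g(m := K)"
  have le': "?g x \<le> K" and nn: "0 \<le> ?g x" for x
    using le log_concave_fun_nonneg[OF g] \<open>0 < K\<close> by auto
  have "?g x powr (1 - s) * ?g y powr s \<le> ?g ((1 - s) * x + s * y)" if s: "s \<in> {0..1}" for x y s
  proof -
    consider "s = 0" | "s = 1" | "(1 - s) * x + s * y = m" | "0 < s" "s < 1" "x = y"
      | "0 < s" "s < 1" "x = m" "y \<noteq> m" "(1 - s) * x + s * y \<noteq> m"
      | "0 < s" "s < 1" "y = m" "x \<noteq> m" "(1 - s) * x + s * y \<noteq> m"
      | "x \<noteq> m" "y \<noteq> m" "(1 - s) * x + s * y \<noteq> m"
      using s by fastforce
    then show ?thesis
    proof cases
      case 3
      have "?g x powr (1 - s) * ?g y powr s \<le> K powr (1 - s) * K powr s"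
        using le' nn s by (intro mult_mono powr_mono2) auto
      also have "\<dots> = K" using \<open>0 < K\<close> by (simp flip: powr_add)
      finally show ?thesis using 3 by simp
    next
      case 4
      have "?g y powr (1 - s) * ?g y powr s = ?g y"
        using nn[of y] by (cases "?g y = 0") (auto simp flip: powr_add)
      with 4 show ?thesis by (simp add: algebra_simps)
    next
      case 5
      then show ?thesis using lim[of s y] by simp
    next
      case 6
      then show ?thesis using lim[of "1 - s" x] by (simp add: algebra_simps)
    next
      case 7
      then show ?thesis using log_concave_funD[OF g, of s x y] s by simp
    qed (use log_concave_fun_nonneg[OF g] \<open>0 < K\<close> in \<open>auto simp: less_imp_le\<close>)
  qed
  then have "log_concave_fun ?g" using nn by (simp add: log_concave_fun_def)
  with \<open>0 < K\<close> le' that show ?thesis by blast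
qed

lemma log_concave_fun_affine:
  assumes "log_concave_fun g"
  shows "log_concave_fun (\<lambda>x. g (t + c * x))"
  unfolding log_concave_fun_def
proof safe
  fix x y s :: real assume "s \<in> {0..1}"
  then show "g (t + c * x) powr (1 - s) * g (t + c * y) powr s \<le> g (t + c * ((1 - s) * x + s * y))"
    using log_concave_funD[OF assms, of s "t + c * x" "t + c * y"] by (simp add: algebra_simps)
qed (rule log_concave_fun_nonneg[OF assms])

lemma log_concave_fun_cmult:
  assumes g: "log_concave_fun g" and "0 < k"
  shows "log_concave_fun (\<lambda>x. k * g x)"
  unfolding log_concave_fun_def
proof safe
  fix x y s :: real assume s: "s \<in> {0..1}"
  have "(k * g x) powr (1 - s) * (k * g y) powr s = (k powr (1 - s) * k powr s) * (g x powr (1 - s) * g y powr s)"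
    using \<open>0 < k\<close> log_concave_fun_nonneg[OF g] by (simp add: powr_mult mult_ac)
  also have "k powr (1 - s) * k powr s = k" using \<open>0 < k\<close> by (simp flip: powr_add)
  finally show "(k * g x) powr (1 - s) * (k * g y) powr s \<le> k * g ((1 - s) * x + s * y)"
    using log_concave_funD[OF g, of s x y] s \<open>0 < k\<close> by simp
qed (use assms log_concave_fun_nonneg in auto)

section \<open>Two-sided exponential distributions\<close>

text \<open>The density is \<open>exp (- x / A)\<close> on the right and \<open>exp (x / B)\<close> on the left of \<open>0\<close>. Written as a
mixture of one-sided exponential densities, it covers the boundary cases \<open>A = 0\<close> and \<open>B = 0\<close>:
the weight annihilates the side whose rate is the meaningless \<open>1 / 0\<close>. At \<open>0\<close> itself both
summands may contribute, so statements about densities must leave out this point.\<close>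

definition two_sided_exp :: "real \<Rightarrow> real \<Rightarrow> real measure" where
  "two_sided_exp A B = density lborel
     (\<lambda>x. ennreal (A * exponential_density (1 / A) x + B * exponential_density (1 / B) (- x)))"

lemma sets_two_sided_exp [simp, measurable_cong]: "sets (two_sided_exp A B) = sets borel"
  by (simp add: two_sided_exp_def)

lemma nn_integral_two_sided_exp:
  assumes AB: "0 \<le> A" "0 \<le> B" and [measurable]: "h \<in> borel_measurable borel"
  shows "(\<integral>\<^sup>+x. h x \<partial>two_sided_exp A B)
    = ennreal A * (\<integral>\<^sup>+x. h x \<partial>density lborel (exponential_density (1 / A)))
    + ennreal B * (\<integral>\<^sup>+x. h (- x) \<partial>density lborel (exponential_density (1 / B)))"
proof -
  let ?e = "\<lambda>C x. ennreal (exponential_density (1 / C) x)"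
  have nn: "0 \<le> exponential_density (1 / C) x" if "0 \<le> C" for C x
    using that by simp
  have "(\<integral>\<^sup>+x. h x \<partial>two_sided_exp A B)
      = (\<integral>\<^sup>+x. ennreal A * (?e A x * h x) + ennreal B * (?e B (- x) * h x) \<partial>lborel)"
    unfolding two_sided_exp_def using AB nn
    by (subst nn_integral_density) (auto simp: ennreal_mult distrib_right mult.assoc)
  also have "\<dots> = ennreal A * (\<integral>\<^sup>+x. ?e A x * h x \<partial>lborel)
      + ennreal B * (\<integral>\<^sup>+x. ?e B (- x) * h x \<partial>lborel)"
    by (simp add: nn_integral_add nn_integral_cmult)
  also have "(\<integral>\<^sup>+x. ?e B (- x) * h x \<partial>lborel) = (\<integral>\<^sup>+x. ?e B x * h (- x) \<partial>lborel)"
    by (subst nn_integral_real_affine[where c = "-1" and t = 0]) auto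
  finally show ?thesis by (simp add: nn_integral_density)
qed

text \<open>By this symmetry, arguments about the right side of \<open>0\<close> serve for the left side too.\<close>

lemma nn_integral_two_sided_exp_reflect:
  assumes "0 \<le> A" "0 \<le> B" and [measurable]: "h \<in> borel_measurable borel"
  shows "(\<integral>\<^sup>+x. h (- x) \<partial>two_sided_exp A B) = (\<integral>\<^sup>+x. h x \<partial>two_sided_exp B A)"
  using assms by (simp add: nn_integral_two_sided_exp add.commute)

lemma prob_exponential_atLeast:
  assumes "0 < l" "0 \<le> a"
  shows "emeasure (density lborel (exponential_density l)) {a..} = ennreal (exp (- a * l))"
proof -
  let ?E = "density lborel (\<lambda>x. ennreal (exponential_density l x))"
  interpret prob_space ?E using \<open>0 < l\<close> by (rule prob_space_exponential_density)
  have le: "emeasure ?E {..a} = ennreal (1 - exp (- l * a))"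
    using emeasure_erlang_density[OF \<open>0 < l\<close>, of 0 a] \<open>0 \<le> a\<close> by (simp add: erlang_CDF_0)
  have "emeasure ?E {..<a} = emeasure ?E {..a}"
    using AE_lborel_singleton[of a]
    by (auto simp: emeasure_density intro!: nn_integral_cong_AE elim!: eventually_mono split: split_indicator)
  then have "prob {..<a} = 1 - exp (- l * a)"
    using le \<open>0 \<le> a\<close> \<open>0 < l\<close> by (simp add: measure_def)
  moreover have "{a..} = space ?E - {..<a}" by auto
  ultimately have "prob {a..} = exp (- l * a)"
    using prob_compl[of "{..<a}"] by simp
  then show ?thesis by (simp add: emeasure_eq_measure mult.commute)
qed

context
  fixes A B :: real
  assumes AB: "0 \<le> A" "0 \<le> B" "A + B = 1"
begin

lemma real_distribution_two_sided_exp: "real_distribution (two_sided_exp A B)"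
proof (rule real_distributionI)
  have *: "ennreal C * emeasure (density lborel (exponential_density (1 / C))) UNIV = ennreal C"
    if "0 \<le> C" for C
  proof (cases "C = 0")
    case False
    with that interpret prob_space "density lborel (exponential_density (1 / C))"
      by (intro prob_space_exponential_density) auto
    show ?thesis using emeasure_space_1 by simp
  qed simp
  have "emeasure (two_sided_exp A B) UNIV = (\<integral>\<^sup>+x. 1 \<partial>two_sided_exp A B)"
    by (simp add: two_sided_exp_def)
  also have "\<dots> = ennreal A + ennreal B"
    using AB by (subst nn_integral_two_sided_exp) (auto simp: *)
  also have "\<dots> = 1" using AB by (simp flip: ennreal_plus)
  finally show "prob_space (two_sided_exp A B)"
    by (intro prob_spaceI) (simp add: two_sided_exp_def)
qed simp

text \<open>For \<open>A = 0\<close> or \<open>B = 0\<close> the formula stays correct, whatever value the quotient in the exponent has,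
because the coefficient of the exponential vanishes.\<close>

lemma cdf_two_sided_exp:
  "cdf (two_sided_exp A B) x = (if 0 \<le> x then 1 - A * exp (- x / A) else B * exp (x / B))"
proof -
  let ?E = "\<lambda>C. density lborel (exponential_density (1 / C))"
  have A: "ennreal A * emeasure (?E A) {..x} = ennreal (if 0 \<le> x then A * (1 - exp (- x / A)) else 0)"
  proof (cases "A = 0")
    case False
    with AB have "0 < 1 / A" by simp
    then show ?thesis
      using AB emeasure_erlang_density[OF \<open>0 < 1 / A\<close>, of 0 x]
      by (auto simp: erlang_CDF_0 ennreal_mult)
  qed simp
  have B: "ennreal B * emeasure (?E B) {- x..} = ennreal (if 0 \<le> x then B else B * exp (x / B))"
  proof (cases "B = 0")
    case False
    with AB have pos: "0 < 1 / B" by simp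
    show ?thesis
    proof (cases "0 \<le> x")
      case True
      interpret prob_space "?E B" by (rule prob_space_exponential_density) fact
      have "emeasure (?E B) {0..} \<le> emeasure (?E B) {- x..}"
        using True by (intro emeasure_mono) auto
      then have "emeasure (?E B) {- x..} = 1"
        using prob_exponential_atLeast[OF pos, of 0] emeasure_le_1[of "{-x..}"] by auto
      with True show ?thesis by simp
    next
      case False
      then show ?thesis using prob_exponential_atLeast[OF pos, of "- x"] AB
        by (simp add: ennreal_mult)
    qed
  qed simp
  have le: "A * exp (- x / A) \<le> A" if "0 \<le> x"
  proof -
    have "exp (- x / A) \<le> 1" using AB that by simp
    then have "A * exp (- x / A) \<le> A * 1" using AB(1) by (rule mult_left_mono)
    then show ?thesis by simp
  qed
  have "emeasure (two_sided_exp A B) {..x} = (\<integral>\<^sup>+z. indicator {..x} z \<partial>two_sided_exp A B)"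
    by simp
  also have "\<dots> = ennreal A * emeasure (?E A) {..x}
      + ennreal B * (\<integral>\<^sup>+z. indicator {..x} (- z) \<partial>?E B)"
    using AB by (subst nn_integral_two_sided_exp) auto
  also have "(\<lambda>z::real. indicator {..x} (- z) :: ennreal) = indicator {- x..}"
    by (auto simp: indicator_def fun_eq_iff)
  also have "(\<integral>\<^sup>+z. indicator {- x..} z \<partial>?E B) = emeasure (?E B) {- x..}"
    by simp
  finally have "emeasure (two_sided_exp A B) {..x} = ennreal (if 0 \<le> x then A * (1 - exp (- x / A)) else 0)
      + ennreal (if 0 \<le> x then B else B * exp (x / B))"
    by (simp only: A B)
  also have "\<dots> = ennreal (if 0 \<le> x then 1 - A * exp (- x / A) else B * exp (x / B))"
  proof (cases "0 \<le> x")
    case True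
    have "0 \<le> A * (1 - exp (- x / A))" using le[OF True] by (simp add: right_diff_distrib)
    moreover have "1 - A * exp (- x / A) = A * (1 - exp (- x / A)) + B"
      using AB by (simp add: right_diff_distrib)
    ultimately show ?thesis using True AB by (simp only: if_True ennreal_plus)
  qed simp
  finally have "cdf (two_sided_exp A B) x = enn2real \<dots>"
    unfolding cdf_def measure_def by simp
  then show ?thesis using AB le by (auto simp: order.trans[of _ A 1])
qed

lemma nn_integral_pos_part_two_sided_exp: "(\<integral>\<^sup>+x. ennreal x \<partial>two_sided_exp A B) = ennreal (A\<^sup>2)"
proof -
  have "(\<integral>\<^sup>+x. ennreal (- x) \<partial>density lborel (exponential_density (1 / B))) = 0"
    by (subst nn_integral_0_iff_AE) (auto simp: AE_density exponential_density_def ennreal_neg intro!: AE_I2)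
  moreover have "ennreal A * (\<integral>\<^sup>+x. ennreal x \<partial>density lborel (exponential_density (1 / A))) = ennreal (A\<^sup>2)"
  proof (cases "A = 0")
    case False
    with AB have pos: "0 < 1 / A" by simp
    have "(\<integral>\<^sup>+x. ennreal x \<partial>density lborel (exponential_density (1 / A)))
        = (\<integral>\<^sup>+x. ennreal (exponential_density (1 / A) x * x ^ 1) \<partial>lborel)"
      using AB by (subst nn_integral_density) (auto simp: ennreal_mult' intro!: nn_integral_cong)
    also have "\<dots> = ennreal A"
      using nn_integral_erlang_ith_moment[OF pos, of 0 1] by simp
    finally show ?thesis using AB by (simp add: power2_eq_square ennreal_mult)
  qed simp
  ultimately show ?thesis using AB by (simp add: nn_integral_two_sided_exp)
qed

end

lemma two_sided_exp_mean:
  assumes AB: "0 \<le> A" "0 \<le> B" "A + B = 1"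
  shows "integrable (two_sided_exp A B) (\<lambda>x. x)" "(\<integral>x. x \<partial>two_sided_exp A B) = A - B"
proof -
  have pos: "(\<integral>\<^sup>+x. ennreal x \<partial>two_sided_exp A B) = ennreal (A\<^sup>2)"
    using AB by (rule nn_integral_pos_part_two_sided_exp)
  have neg: "(\<integral>\<^sup>+x. ennreal (- x) \<partial>two_sided_exp A B) = ennreal (B\<^sup>2)"
    using AB nn_integral_pos_part_two_sided_exp[of B A] by (subst nn_integral_two_sided_exp_reflect) auto
  show int: "integrable (two_sided_exp A B) (\<lambda>x. x)"
    using pos neg by (subst real_integrable_def) auto
  have "(\<integral>x. x \<partial>two_sided_exp A B) = A\<^sup>2 - B\<^sup>2"
    using pos neg by (subst real_lebesgue_integral_def[OF int]) simp
  also have "\<dots> = (A + B) * (A - B)" by (simp add: power2_eq_square algebra_simps)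
  finally show "(\<integral>x. x \<partial>two_sided_exp A B) = A - B" using AB by simp
qed

section \<open>Log-concave densities against two-sided exponential densities\<close>

text \<open>One density must be below the other somewhere on a set to which it gives less mass. An arbitrary
null point \<open>a\<close> may be avoided; it will be \<open>0\<close>, where the two-sided exponential density
does not have its regular value.\<close>

lemma density_less_imp_ex:
  fixes f h :: "real \<Rightarrow> real"
  assumes [measurable]: "f \<in> borel_measurable borel" "h \<in> borel_measurable borel" "S \<in> sets borel"
    and fin: "finite_measure (density lborel f)"
    and less: "measure (density lborel f) S < measure (density lborel h) S"
  shows "\<exists>u\<in>S. u \<noteq> a \<and> f u < h u"
proof (rule ccontr)
  assume no: "\<not> ?thesis"
  have "AE u in lborel. ennreal (h u) * indicator S u \<le> ennreal (f u) * indicator S u"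
    using AE_lborel_singleton[of a]
    by eventually_elim (use no in \<open>auto simp: indicator_def not_less intro: ennreal_leI\<close>)
  then have "emeasure (density lborel h) S \<le> emeasure (density lborel f) S"
    by (auto simp: emeasure_density intro: nn_integral_mono_AE)
  then have "measure (density lborel h) S \<le> measure (density lborel f) S"
    unfolding measure_def using finite_measure.emeasure_finite[OF fin, of S]
    by (intro enn2real_mono) (auto simp: less_top)
  with less show False by simp
qed

lemma measure_density_lborel_singleton [simp]:
  fixes f :: "real \<Rightarrow> ennreal"
  assumes [measurable]: "f \<in> borel_measurable borel"
  shows "measure (density lborel f) {a} = 0"
proof -
  have "emeasure (density lborel f) {a} = (\<integral>\<^sup>+x. 0 \<partial>(lborel::real measure))"
    using AE_lborel_singleton[of a]
    by (subst emeasure_density) (auto intro!: nn_integral_cong_AE elim!: eventually_mono)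
  then show ?thesis by (simp add: measure_def)
qed

lemma (in real_distribution) measure_atLeastAtMost_cdf:
  assumes "a \<le> b" "measure M {a} = 0"
  shows "measure M {a..b} = cdf M b - cdf M a"
proof (cases "a = b")
  case False
  have "{a..b} = {a} \<union> {a<..b}" using assms by auto
  also have "measure M \<dots> = measure M {a} + measure M {a<..b}"
    by (rule finite_measure_Union) auto
  finally have "measure M {a..b} = measure M {a} + measure M {a<..b}" .
  with False assms cdf_diff_eq[of a b] show ?thesis by simp
qed (use assms in simp)

lemma (in real_distribution) measure_greaterThan_cdf: "measure M {a<..} = 1 - cdf M a"
proof -
  have "{a<..} = space M - {..a}" by auto
  then show ?thesis using prob_compl[of "{..a}"] by (simp add: cdf_def)
qed

lemma (in real_distribution) measure_atLeast_cdf: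
  assumes "measure M {a} = 0"
  shows "measure M {a..} = 1 - cdf M a"
proof -
  have "{a..} = {a} \<union> {a<..}" by auto
  also have "measure M \<dots> = measure M {a} + measure M {a<..}"
    by (rule finite_measure_Union) auto
  finally show ?thesis using assms by (simp add: measure_greaterThan_cdf)
qed

text \<open>A concave function that lies above an affine one at two points lies above it in between; the lemma
states this for logarithms.\<close>

lemma log_concave_fun_above_exp:
  assumes g: "log_concave_fun g" and ord: "u < v" "v < w"
    and le: "exp (b * u) \<le> g u" "exp (b * w) \<le> g w"
  shows "exp (b * v) \<le> g v"
proof -
  define s where "s = (v - u) / (w - u)"
  have s: "0 \<le> s" "s \<le> 1" using ord by (auto simp: s_def divide_simps)
  have "s * (w - u) = v - u" using ord by (simp add: s_def)
  then have v: "(1 - s) * u + s * w = v" by (simp add: algebra_simps)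
  have "exp (b * v) = exp (b * u) powr (1 - s) * exp (b * w) powr s"
    unfolding v[symmetric] by (simp add: powr_def algebra_simps flip: exp_add)
  also have "\<dots> \<le> g u powr (1 - s) * g w powr s"
    using le s by (intro mult_mono powr_mono2) auto
  also have "\<dots> \<le> g v" using log_concave_funD[OF g s, of u w] by (simp add: v)
  finally show ?thesis .
qed

lemma distr_density_lborel_affine:
  fixes g :: "real \<Rightarrow> real"
  assumes [measurable]: "g \<in> borel_measurable borel" and c: "c \<noteq> 0"
  shows "distr (density lborel (\<lambda>x. ennreal (g x))) borel (\<lambda>x. t + c * x)
    = density lborel (\<lambda>x. ennreal (g ((x - t) / c) / \<bar>c\<bar>))"
proof (rule measure_eqI)
  fix S :: "real set"
  assume "S \<in> sets (distr (density lborel (\<lambda>x. ennreal (g x))) borel (\<lambda>x. t + c * x))"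
  then have [measurable]: "S \<in> sets borel" by simp
  have "emeasure (density lborel (\<lambda>x. ennreal (g ((x - t) / c) / \<bar>c\<bar>))) S
      = ennreal \<bar>c\<bar> * (\<integral>\<^sup>+x. ennreal (g x / \<bar>c\<bar>) * indicator S (t + c * x) \<partial>lborel)"
    using c by (simp add: emeasure_density) (subst nn_integral_real_affine[where c = c and t = t], auto)
  also have "\<dots> = (\<integral>\<^sup>+x. ennreal (\<bar>c\<bar> * (g x / \<bar>c\<bar>)) * indicator S (t + c * x) \<partial>lborel)"
    by (subst nn_integral_cmult[symmetric]) (auto simp flip: mult.assoc ennreal_mult')
  also have "\<dots> = (\<integral>\<^sup>+x. ennreal (g x) * indicator ((\<lambda>x. t + c * x) -` S) x \<partial>lborel)"
    using c by (intro nn_integral_cong) (auto simp: indicator_def)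
  also have "\<dots> = emeasure (density lborel (\<lambda>x. ennreal (g x))) ((\<lambda>x. t + c * x) -` S)"
    using measurable_sets_borel[of "\<lambda>x. t + c * x" borel S] by (subst emeasure_density) auto
  finally show "emeasure (distr (density lborel (\<lambda>x. ennreal (g x))) borel (\<lambda>x. t + c * x)) S
      = emeasure (density lborel (\<lambda>x. ennreal (g ((x - t) / c) / \<bar>c\<bar>))) S"
    by (simp add: emeasure_distr)
qed simp

lemma two_sided_exp_density_pos:
  "0 < A \<Longrightarrow> 0 < x \<Longrightarrow> A * exponential_density (1 / A) x + B * exponential_density (1 / B) (- x) = exp (- 1 / A * x)"
  by (simp add: exponential_density_def)

text \<open>Both distributions have mass \<open>A\<close> on the positive half-line. If \<open>g\<close> had less mass on
\<open>(0, x]\<close>, it would be below the exponential somewhere on \<open>(0, x]\<close> and above it somewhere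
beyond \<open>x\<close>. As \<open>g 0\<close> is at least \<open>1\<close>, this contradicts log-concavity.\<close>

lemma log_concave_cdf_ge_two_sided_exp:
  assumes g: "log_concave_fun g" and P: "real_distribution (density lborel g)" and g0: "1 \<le> g 0"
    and AB: "A = measure (density lborel g) {0<..}" "B = measure (density lborel g) {..0}"
    and x: "0 \<le> x"
  shows "cdf (two_sided_exp A B) x \<le> cdf (density lborel g) x"
proof -
  let ?h = "\<lambda>x. A * exponential_density (1 / A) x + B * exponential_density (1 / B) (- x)"
  let ?P = "density lborel g"
  interpret P: real_distribution ?P by fact
  have [measurable]: "g \<in> borel_measurable borel" by (rule log_concave_fun_measurable[OF g])
  have "A = 1 - B" using P.measure_greaterThan_cdf[of 0] AB by (simp add: cdf_def)
  then have ab: "0 \<le> A" "0 \<le> B" "A + B = 1" using AB by auto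
  interpret Y: real_distribution "two_sided_exp A B" by (rule real_distribution_two_sided_exp[OF ab])
  have Yfin: "finite_measure (density lborel ?h)" "finite_measure ?P"
    using Y.finite_measure_axioms P.finite_measure_axioms by (simp_all add: two_sided_exp_def)
  have P0: "cdf ?P 0 = cdf (two_sided_exp A B) 0"
    using AB ab by (simp add: cdf_def[of ?P] cdf_two_sided_exp)
  have hmeas: "?h \<in> borel_measurable borel" by simp
  show ?thesis
  proof (cases "x = 0")
    case True with P0 show ?thesis by simp
  next
    case False
    with x have "0 < x" by simp
    show ?thesis
    proof (cases "A = 0")
      case True
      then have "cdf ?P 0 = 1" using P0 unfolding cdf_two_sided_exp[OF ab] by simp
      then show ?thesis
        using P.cdf_nondecreasing[OF x] Y.cdf_bounded_prob[of x] by linarith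
    next
      case False
      with ab have "0 < A" by simp
      note h = two_sided_exp_density_pos[OF \<open>0 < A\<close>, of _ B]
      show ?thesis
      proof (rule ccontr)
        assume "\<not> ?thesis"
        then have less: "cdf ?P x < cdf (two_sided_exp A B) x" by simp
        have "measure ?P {0<..x} < measure (density lborel ?h) {0<..x}"
          using less P0 P.cdf_diff_eq[OF \<open>0 < x\<close>] Y.cdf_diff_eq[OF \<open>0 < x\<close>]
          by (simp add: two_sided_exp_def)
        from density_less_imp_ex[OF _ _ _ Yfin(2) this, of 0] obtain v
          where v: "0 < v" "v \<le> x" "g v < exp (- 1 / A * v)"
          using h by auto
        have "measure (density lborel ?h) {x<..} < measure ?P {x<..}"
          using less P.measure_greaterThan_cdf[of x] Y.measure_greaterThan_cdf[of x]
          by (simp add: two_sided_exp_def)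
        from density_less_imp_ex[OF _ _ _ Yfin(1) this, of 0] obtain w
          where w: "x < w" "exp (- 1 / A * w) < g w"
          using h x by auto
        have "exp (- 1 / A * v) \<le> g v"
          using v w g0 by (intro log_concave_fun_above_exp[OF g, of 0 v w]) auto
        with v show False by simp
      qed
    qed
  qed
qed

text \<open>Suppose that the difference of the distribution functions is nonnegative up to \<open>0\<close>, negative at
\<open>x\<close>, and positive at a later point \<open>y\<close>. The masses of \<open>(0, x]\<close>, \<open>(x, y]\<close> and
\<open>(y, \<infinity>)\<close> show that \<open>g\<close> is above, below and again above the exponential density at three
successive points, which is impossible for a log-concave function.\<close>

lemma log_concave_cdf_crosses_two_sided_exp:
  assumes g: "log_concave_fun g" and P: "real_distribution (density lborel g)"
    and ab: "0 \<le> A" "0 \<le> B" "A + B = 1"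
    and left: "\<And>x. x \<le> 0 \<Longrightarrow> cdf (density lborel g) x \<le> cdf (two_sided_exp A B) x"
    and xy: "x < y" and less: "cdf (two_sided_exp A B) x < cdf (density lborel g) x"
  shows "cdf (two_sided_exp A B) y \<le> cdf (density lborel g) y"
proof -
  let ?h = "\<lambda>x. A * exponential_density (1 / A) x + B * exponential_density (1 / B) (- x)"
  let ?P = "density lborel g"
  interpret P: real_distribution ?P by fact
  have [measurable]: "g \<in> borel_measurable borel" by (rule log_concave_fun_measurable[OF g])
  interpret Y: real_distribution "two_sided_exp A B" by (rule real_distribution_two_sided_exp[OF ab])
  have Yfin: "finite_measure (density lborel ?h)" "finite_measure ?P"
    using Y.finite_measure_axioms P.finite_measure_axioms by (simp_all add: two_sided_exp_def)
  have "0 < x" using left[of x] less by (cases "x \<le> 0") auto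
  have "A \<noteq> 0"
  proof
    assume "A = 0"
    then have "cdf (two_sided_exp A B) x = 1" using \<open>0 < x\<close> unfolding cdf_two_sided_exp[OF ab] by simp
    with less P.cdf_bounded_prob[of x] show False by simp
  qed
  with ab have "0 < A" by simp
  note h = two_sided_exp_density_pos[OF \<open>0 < A\<close>, of _ B]
  show ?thesis
  proof (rule ccontr)
    assume "\<not> ?thesis"
    then have lessy: "cdf ?P y < cdf (two_sided_exp A B) y" by simp
    have "measure (density lborel ?h) {0<..x} < measure ?P {0<..x}"
      using less left[of 0] P.cdf_diff_eq[OF \<open>0 < x\<close>] Y.cdf_diff_eq[OF \<open>0 < x\<close>]
      by (simp add: two_sided_exp_def)
    from density_less_imp_ex[OF _ _ _ Yfin(1) this, of 0] obtain u
      where u: "0 < u" "u \<le> x" "exp (- 1 / A * u) < g u"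
      using h by auto
    have "measure ?P {x<..y} < measure (density lborel ?h) {x<..y}"
      using less lessy P.cdf_diff_eq[OF xy] Y.cdf_diff_eq[OF xy]
      by (simp add: two_sided_exp_def)
    from density_less_imp_ex[OF _ _ _ Yfin(2) this, of 0] obtain v
      where v: "x < v" "v \<le> y" "g v < exp (- 1 / A * v)"
      using h \<open>0 < x\<close> by auto
    have "measure (density lborel ?h) {y<..} < measure ?P {y<..}"
      using lessy P.measure_greaterThan_cdf[of y] Y.measure_greaterThan_cdf[of y]
      by (simp add: two_sided_exp_def)
    from density_less_imp_ex[OF _ _ _ Yfin(1) this, of 0] obtain w
      where w: "y < w" "exp (- 1 / A * w) < g w"
      using h \<open>0 < x\<close> xy by auto
    have "exp (- 1 / A * v) \<le> g v"
      using u v w by (intro log_concave_fun_above_exp[OF g, of u v w]) auto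
    with v show False by simp
  qed
qed

section \<open>The two-sided exponential maximises convex central moments\<close>

lemma density_lborel_reflect:
  fixes g :: "real \<Rightarrow> real"
  assumes "g \<in> borel_measurable borel"
  shows "density lborel (\<lambda>x. ennreal (g (- x))) = distr (density lborel g) borel uminus"
  using distr_density_lborel_affine[OF assms, of "-1" 0] by simp

lemma log_concave_fun_reflect: "log_concave_fun g \<Longrightarrow> log_concave_fun (\<lambda>x. g (- x))"
  using log_concave_fun_affine[of g 0 "-1"] by simp

lemma convex_on_affine:
  fixes \<phi> :: "real \<Rightarrow> real"
  assumes "convex_on UNIV \<phi>"
  shows "convex_on UNIV (\<lambda>x. \<phi> (t + c * x))"
proof (rule convex_onI)
  fix s x y :: real assume "0 < s" "s < 1"
  then have "\<phi> ((1 - s) * (t + c * x) + s * (t + c * y)) \<le> (1 - s) * \<phi> (t + c * x) + s * \<phi> (t + c * y)"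
    using convex_onD[OF assms, of s "t + c * x" "t + c * y"] by simp
  also have "(1 - s) * (t + c * x) + s * (t + c * y) = t + c * ((1 - s) *\<^sub>R x + s *\<^sub>R y)"
    by (simp add: algebra_simps)
  finally show "\<phi> (t + c * ((1 - s) *\<^sub>R x + s *\<^sub>R y)) \<le> (1 - s) * \<phi> (t + c * x) + s * \<phi> (t + c * y)" .
qed simp

text \<open>The positive part of a variable with density \<open>g\<close> is stochastically smaller than that of the
two-sided exponential variable.\<close>

lemma nn_integral_pos_part_log_concave:
  assumes g: "log_concave_fun g" and P: "real_distribution (density lborel g)" and g0: "1 \<le> g 0"
  shows "(\<integral>\<^sup>+x. ennreal x \<partial>density lborel g) < \<infinity>"
proof -
  let ?P = "density lborel g"
  interpret P: real_distribution ?P by fact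
  define A B where AB: "A = measure ?P {0<..}" "B = measure ?P {..0}"
  have "A = 1 - B" using P.measure_greaterThan_cdf[of 0] AB by (simp add: cdf_def)
  then have ab: "0 \<le> A" "0 \<le> B" "A + B = 1" using AB by auto
  interpret Y: real_distribution "two_sided_exp A B" by (rule real_distribution_two_sided_exp[OF ab])
  have cdf: "cdf (distr M borel (max 0)) x = (if x < 0 then 0 else cdf M x)"
    if "real_distribution M" for M :: "real measure" and x
  proof -
    interpret real_distribution M by fact
    have "max 0 -` {..x} = (if x < 0 then {} else {..x})" by auto
    then show ?thesis by (simp add: cdf_def measure_distr)
  qed
  have "(\<integral>\<^sup>+x. ennreal x \<partial>distr ?P borel (max 0)) \<le> (\<integral>\<^sup>+x. ennreal x \<partial>distr (two_sided_exp A B) borel (max 0))"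
  proof (rule nn_integral_mono_stochastic_order)
    show "cdf (distr (two_sided_exp A B) borel (max 0)) x \<le> cdf (distr ?P borel (max 0)) x" for x
      using log_concave_cdf_ge_two_sided_exp[OF g P g0 AB, of x]
      by (simp add: cdf P Y.real_distribution_axioms)
  qed (auto intro!: monoI ennreal_leI P.real_distribution_distr Y.real_distribution_distr)
  moreover have "ennreal (max 0 x) = ennreal x" for x
    by (cases "0 \<le> x") (auto simp: ennreal_neg max_def)
  ultimately have "(\<integral>\<^sup>+x. ennreal x \<partial>?P) \<le> (\<integral>\<^sup>+x. ennreal x \<partial>two_sided_exp A B)"
    by (simp add: nn_integral_distr)
  also have "\<dots> < \<infinity>" using nn_integral_pos_part_two_sided_exp[OF ab] by simp
  finally show ?thesis .
qed

lemma integrable_log_concave: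
  assumes g: "log_concave_fun g" and P: "real_distribution (density lborel g)" and g0: "1 \<le> g 0"
  shows "integrable (density lborel g) (\<lambda>x. x)"
proof -
  have [measurable]: "g \<in> borel_measurable borel" by (rule log_concave_fun_measurable[OF g])
  interpret P: real_distribution "density lborel g" by fact
  have refl: "density lborel (\<lambda>x. ennreal (g (- x))) = distr (density lborel g) borel uminus"
    by (rule density_lborel_reflect) simp
  have "(\<integral>\<^sup>+x. ennreal x \<partial>density lborel (\<lambda>x. ennreal (g (- x)))) < \<infinity>"
    using g0 by (intro nn_integral_pos_part_log_concave log_concave_fun_reflect[OF g])
      (auto simp: refl intro!: P.real_distribution_distr)
  then have "(\<integral>\<^sup>+x. ennreal (- x) \<partial>density lborel g) < \<infinity>"
    unfolding refl by (subst (asm) nn_integral_distr) auto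
  with nn_integral_pos_part_log_concave[OF assms] show ?thesis
    by (subst real_integrable_def) auto
qed

text \<open>This is the reflection of \<open>log_concave_cdf_ge_two_sided_exp\<close>.\<close>

lemma log_concave_cdf_le_two_sided_exp:
  assumes g: "log_concave_fun g" and P: "real_distribution (density lborel g)" and g0: "1 \<le> g 0"
    and AB: "A = measure (density lborel g) {0<..}" "B = measure (density lborel g) {..0}"
    and x: "x \<le> 0"
  shows "cdf (density lborel g) x \<le> cdf (two_sided_exp A B) x"
proof -
  let ?P = "density lborel g"
  let ?R = "density lborel (\<lambda>x. ennreal (g (- x)))"
  have [measurable]: "g \<in> borel_measurable borel" by (rule log_concave_fun_measurable[OF g])
  interpret P: real_distribution ?P by fact
  have refl: "?R = distr ?P borel uminus" by (rule density_lborel_reflect) simp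
  have R: "real_distribution ?R" unfolding refl by (rule P.real_distribution_distr) simp
  interpret R: real_distribution ?R by fact
  have atom: "measure ?P {a} = 0" for a by simp
  have mR: "measure ?R {..a} = 1 - cdf ?P (- a)" for a
  proof -
    have "uminus -` {..a} = {- a..}" by auto
    then show ?thesis unfolding refl
      by (simp add: measure_distr P.measure_atLeast_cdf[OF atom])
  qed
  have B: "B = measure ?R {0<..}" "A = measure ?R {..0}"
    using R.measure_greaterThan_cdf[of 0] P.measure_greaterThan_cdf[of 0] mR[of 0]
    by (simp_all add: AB cdf_def)
  have "A = 1 - B" using P.measure_greaterThan_cdf[of 0] AB by (simp add: cdf_def)
  then have ab: "0 \<le> A" "0 \<le> B" "A + B = 1" using AB by auto
  have ba: "0 \<le> B" "0 \<le> A" "B + A = 1" using ab by auto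
  have "cdf (two_sided_exp B A) (- x) \<le> cdf ?R (- x)"
    using x g0 by (intro log_concave_cdf_ge_two_sided_exp[OF log_concave_fun_reflect[OF g] R _ B]) auto
  also have "\<dots> = 1 - cdf ?P x" using mR[of "- x"] by (simp add: cdf_def)
  also have "cdf (two_sided_exp B A) (- x) = 1 - cdf (two_sided_exp A B) x"
    unfolding cdf_two_sided_exp[OF ab] cdf_two_sided_exp[OF ba] using x ab by auto
  finally show ?thesis by simp
qed

text \<open>A shift by \<open>d \<ge> 0\<close> gives \<open>g\<close> the mean \<open>A - B\<close>. Moving mass to the right only lowers the
distribution function, so the comparison on the left half-line persists, and on the right half-line
there is at most one crossing.\<close>

lemma convex_order_two_sided_exp_mean_le:
  fixes \<phi> :: "real \<Rightarrow> real"
  assumes g: "log_concave_fun g" and P: "real_distribution (density lborel g)" and g0: "1 \<le> g 0"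
    and AB: "A = measure (density lborel g) {0<..}" "B = measure (density lborel g) {..0}"
    and cvx: "convex_on UNIV \<phi>" and nonneg: "\<And>x. 0 \<le> \<phi> x"
    and mean: "(\<integral>x. x \<partial>density lborel g) \<le> A - B"
  shows "(\<integral>\<^sup>+x. ennreal (\<phi> (x - (\<integral>x. x \<partial>density lborel g))) \<partial>density lborel g)
    \<le> (\<integral>\<^sup>+y. ennreal (\<phi> (y - (A - B))) \<partial>two_sided_exp A B)"
proof -
  let ?P = "density lborel g"
  have [measurable]: "g \<in> borel_measurable borel" by (rule log_concave_fun_measurable[OF g])
  have [measurable]: "\<phi> \<in> borel_measurable borel"
    using convex_on_continuous[OF open_UNIV cvx] by (rule borel_measurable_continuous_onI)
  interpret P: real_distribution ?P by fact
  have "A = 1 - B" using P.measure_greaterThan_cdf[of 0] AB by (simp add: cdf_def)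
  then have ab: "0 \<le> A" "0 \<le> B" "A + B = 1" using AB by auto
  define d where "d = A - B - (\<integral>x. x \<partial>?P)"
  have "0 \<le> d" using mean by (simp add: d_def)
  let ?Q = "density lborel (\<lambda>x. ennreal (g (- d + 1 * x)))"
  have Q: "?Q = distr ?P borel (\<lambda>x. d + 1 * x)"
    by (subst distr_density_lborel_affine) (auto simp: add.commute)
  have dist: "real_distribution ?Q" unfolding Q by (rule P.real_distribution_distr) simp
  have int: "integrable ?P (\<lambda>x. x)" by (rule integrable_log_concave[OF g P g0])
  have cdfQ: "cdf ?Q x = cdf ?P (x - d)" for x
  proof -
    have "(\<lambda>x. d + 1 * x) -` {..x} = {..x - d}" by auto
    then show ?thesis unfolding Q by (simp add: cdf_def measure_distr)
  qed
  have "(\<integral>\<^sup>+x. ennreal (\<phi> (- (A - B) + 1 * x)) \<partial>?Q) \<le> (\<integral>\<^sup>+x. ennreal (\<phi> (- (A - B) + 1 * x)) \<partial>two_sided_exp A B)"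
  proof (rule convex_order_of_cdf_crossing[OF dist real_distribution_two_sided_exp[OF ab]])
    have "integrable ?P (\<lambda>x. d + 1 * x)"
      using int by (intro Bochner_Integration.integrable_add) simp_all
    then show "integrable ?Q (\<lambda>x. x)"
      unfolding Q by (intro iffD2[OF integrable_distr_eq]) simp_all
    have "(\<integral>x. x \<partial>?Q) = (\<integral>x. d + 1 * x \<partial>?P)"
      unfolding Q by (rule integral_distr) simp_all
    also have "\<dots> = d + (\<integral>x. x \<partial>?P)"
      using int P.prob_space by simp
    also have "\<dots> = A - B" by (simp add: d_def)
    finally show "(\<integral>x. x \<partial>?Q) = (\<integral>x. x \<partial>two_sided_exp A B)"
      by (simp only: two_sided_exp_mean(2)[OF ab])
    show "integrable (two_sided_exp A B) (\<lambda>x. x)" by (rule two_sided_exp_mean(1)[OF ab])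
    have left: "cdf ?Q x \<le> cdf (two_sided_exp A B) x" if "x \<le> 0" for x
    proof -
      have "cdf ?Q x \<le> cdf ?P x" unfolding cdfQ using \<open>0 \<le> d\<close> by (intro P.cdf_nondecreasing) auto
      also have "\<dots> \<le> cdf (two_sided_exp A B) x"
        by (rule log_concave_cdf_le_two_sided_exp[OF g P g0 AB that])
      finally show ?thesis .
    qed
    show "cdf (two_sided_exp A B) y \<le> cdf ?Q y"
      if "x < y" "cdf (two_sided_exp A B) x < cdf ?Q x" for x y
      by (rule log_concave_cdf_crosses_two_sided_exp[OF log_concave_fun_affine[OF g] dist ab left that])
    show "convex_on UNIV (\<lambda>x. \<phi> (- (A - B) + 1 * x))" by (rule convex_on_affine[OF cvx])
  qed (rule nonneg)
  also have "(\<integral>\<^sup>+x. ennreal (\<phi> (- (A - B) + 1 * x)) \<partial>?Q) = (\<integral>\<^sup>+x. ennreal (\<phi> (x - (\<integral>x. x \<partial>?P))) \<partial>?P)"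
    unfolding Q by (subst nn_integral_distr) (auto simp: d_def algebra_simps)
  finally show ?thesis by (simp add: algebra_simps)
qed

text \<open>If the mean of \<open>g\<close> exceeds \<open>A - B\<close>, the shift would go to the left; reflecting \<open>g\<close> reduces this
case to the previous one.\<close>

lemma convex_order_two_sided_exp:
  fixes \<phi> :: "real \<Rightarrow> real"
  assumes g: "log_concave_fun g" and P: "real_distribution (density lborel g)" and g0: "1 \<le> g 0"
    and AB: "A = measure (density lborel g) {0<..}" "B = measure (density lborel g) {..0}"
    and cvx: "convex_on UNIV \<phi>" and nonneg: "\<And>x. 0 \<le> \<phi> x"
  shows "(\<integral>\<^sup>+x. ennreal (\<phi> (x - (\<integral>x. x \<partial>density lborel g))) \<partial>density lborel g)
    \<le> (\<integral>\<^sup>+y. ennreal (\<phi> (y - (A - B))) \<partial>two_sided_exp A B)"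
proof (cases "(\<integral>x. x \<partial>density lborel g) \<le> A - B")
  case True
  then show ?thesis by (rule convex_order_two_sided_exp_mean_le[OF assms])
next
  case False
  let ?P = "density lborel g"
  let ?R = "density lborel (\<lambda>x. ennreal (g (- x)))"
  have [measurable]: "g \<in> borel_measurable borel" by (rule log_concave_fun_measurable[OF g])
  have [measurable]: "\<phi> \<in> borel_measurable borel"
    using convex_on_continuous[OF open_UNIV cvx] by (rule borel_measurable_continuous_onI)
  interpret P: real_distribution ?P by fact
  have refl: "?R = distr ?P borel uminus" by (rule density_lborel_reflect) simp
  have R: "real_distribution ?R" unfolding refl by (rule P.real_distribution_distr) simp
  have atom: "measure ?P {a} = 0" for a by simp
  have "A = 1 - B" using P.measure_greaterThan_cdf[of 0] AB by (simp add: cdf_def)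
  then have ab: "0 \<le> A" "0 \<le> B" using AB by auto
  have BA: "B = measure ?R {0<..}" "A = measure ?R {..0}"
  proof -
    have "uminus -` {..0} = {0::real..}" by auto
    then show "A = measure ?R {..0}" unfolding refl
      using P.measure_greaterThan_cdf[of 0] by (simp add: AB measure_distr P.measure_atLeast_cdf[OF atom])
    then show "B = measure ?R {0<..}"
      using real_distribution.measure_greaterThan_cdf[OF R, of 0] \<open>A = 1 - B\<close> by (simp add: cdf_def)
  qed
  have meanR: "(\<integral>x. x \<partial>?R) = - (\<integral>x. x \<partial>?P)"
    unfolding refl by (subst integral_distr) auto
  have "convex_on UNIV (\<lambda>x. \<phi> (- x))" using convex_on_affine[OF cvx, of 0 "-1"] by simp
  then have "(\<integral>\<^sup>+x. ennreal (\<phi> (- (x - (\<integral>x. x \<partial>?R)))) \<partial>?R)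
      \<le> (\<integral>\<^sup>+y. ennreal (\<phi> (- (y - (B - A)))) \<partial>two_sided_exp B A)"
    using False g0 meanR
    by (intro convex_order_two_sided_exp_mean_le[OF log_concave_fun_reflect[OF g] R _ BA])
      (auto simp: nonneg)
  also have "\<dots> = (\<integral>\<^sup>+y. ennreal (\<phi> (y - (A - B))) \<partial>two_sided_exp A B)"
    using ab by (subst nn_integral_two_sided_exp_reflect[symmetric]) (auto simp: algebra_simps)
  also have "(\<integral>\<^sup>+x. ennreal (\<phi> (- (x - (\<integral>x. x \<partial>?R)))) \<partial>?R)
      = (\<integral>\<^sup>+x. ennreal (\<phi> (x - (\<integral>x. x \<partial>?P))) \<partial>?P)"
    unfolding meanR unfolding refl by (subst nn_integral_distr) (auto simp: algebra_simps)
  finally show ?thesis .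
qed

section \<open>Deviations of two-sided exponential variables from the mean\<close>

text \<open>Here \<open>F A B\<close> is the distribution function of the two-sided exponential law, with mean \<open>A - B\<close>, and
\<open>F 1 0\<close> that of the standard exponential law, with mean \<open>1\<close>. So the inequality compares the
probabilities of a deviation of at most \<open>t\<close> from the mean.

For \<open>t \<le> A - B\<close> it follows from \<open>A * exp (1 / A - 1) \<ge> 1\<close> and \<open>t / A \<ge> t\<close>. For \<open>t > 1\<close> it holds for each of
the two exponential tails separately. In the range between, put \<open>r = 1 - t\<close>: the difference
\<open>\<psi> r\<close> of the two sides is convex on \<open>[0, 2 * B]\<close>, vanishes at \<open>0\<close>, and is at most \<open>0\<close> at
\<open>2 * B\<close> because this endpoint corresponds to \<open>t = A - B\<close>.\<close>

lemma two_sided_exp_cdf_central_ge: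
  fixes F :: "real \<Rightarrow> real \<Rightarrow> real \<Rightarrow> real"
  defines "F \<equiv> \<lambda>A B x. if 0 \<le> x then 1 - A * exp (- x / A) else B * exp (x / B)"
  assumes AB: "0 \<le> B" "B \<le> A" "A + B = 1" and t: "0 \<le> t"
  shows "F 1 0 (1 + t) - F 1 0 (1 - t) \<le> F A B (A - B + t) - F A B (A - B - t)"
proof (cases "B = 0")
  case False
  with AB have pos: "0 < A" "0 < B" "A < 1" "B < 1" by auto
  have B: "B = 1 - A" using AB by simp
  have small: "exp (t - 1) - exp (- 1 - t) \<le> A * (exp (- (A - B - t) / A) - exp (- (A - B + t) / A))"
    if t: "0 \<le> t" for t
  proof -
    have "exp (t - 1) - exp (- 1 - t) = exp (- 1) * (exp t - exp (- t))"
      by (simp add: algebra_simps flip: exp_add)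
    also have "\<dots> \<le> exp (- 1) * (exp (t / A) - exp (- t / A))"
    proof -
      have "t * A \<le> t * 1" using t pos by (intro mult_left_mono) auto
      then have "t \<le> t / A" using pos by (simp add: field_simps)
      then show ?thesis by (intro mult_left_mono diff_mono) auto
    qed
    also have "\<dots> \<le> (A * exp (1 / A - 2)) * (exp (t / A) - exp (- t / A))"
    proof (rule mult_right_mono)
      have "A * (1 + (1 / A - 1)) \<le> A * exp (1 / A - 1)"
        using pos by (intro mult_left_mono exp_ge_add_one_self) auto
      then have "1 \<le> A * exp (1 / A - 1)" using pos by simp
      then have "exp (- 1) * 1 \<le> exp (- 1) * (A * exp (1 / A - 1))"
        by (intro mult_left_mono) auto
      also have "\<dots> = A * exp (1 / A - 2)" by (simp add: mult.left_commute flip: exp_add)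
      finally show "exp (- 1) \<le> A * exp (1 / A - 2)" by simp
      show "0 \<le> exp (t / A) - exp (- t / A)"
      proof -
        have "- t / A \<le> t / A" using t pos by (intro divide_right_mono) auto
        then show ?thesis by simp
      qed
    qed
    also have "\<dots> = A * (exp (1 / A - 2 + t / A) - exp (1 / A - 2 - t / A))"
      by (simp add: right_diff_distrib exp_add exp_diff exp_minus field_simps)
    also have "1 / A - 2 + t / A = - (A - B - t) / A" using pos by (simp add: B field_simps)
    also have "1 / A - 2 - t / A = - (A - B + t) / A" using pos by (simp add: B field_simps)
    finally show ?thesis .
  qed
  consider "t \<le> A - B" | "A - B < t" "t \<le> 1" | "1 < t" by linarith
  then show ?thesis
  proof cases
    case 1
    then show ?thesis using small[OF t] t AB unfolding F_def by (simp add: right_diff_distrib)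
  next
    case 2
    define \<psi> where "\<psi> r = A * exp (r / A - 2) + B * exp (r / B - 2) + exp (- r) - exp (r - 2) - 1" for r
    define r where "r = 1 - t"
    have r: "0 \<le> r" "r \<le> 2 * B" using 2 AB by (auto simp: r_def)
    have "convex_on {0..2 * B} \<psi>"
    proof (rule f''_ge0_imp_convex)
      fix r assume r: "r \<in> {0..2 * B}"
      show "(\<psi> has_real_derivative exp (r / A - 2) + exp (r / B - 2) - exp (- r) - exp (r - 2)) (at r)"
        unfolding \<psi>_def using pos by (auto intro!: derivative_eq_intros)
      show "((\<lambda>r. exp (r / A - 2) + exp (r / B - 2) - exp (- r) - exp (r - 2)) has_real_derivative
          exp (r / A - 2) / A + exp (r / B - 2) / B + exp (- r) - exp (r - 2)) (at r)"
        using pos by (auto intro!: derivative_eq_intros)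
      have "exp (r - 2) \<le> exp (- r)" using r AB by simp
      moreover have "0 \<le> exp (r / A - 2) / A" "0 \<le> exp (r / B - 2) / B" using pos by auto
      ultimately show "0 \<le> exp (r / A - 2) / A + exp (r / B - 2) / B + exp (- r) - exp (r - 2)"
        by linarith
    qed simp
    then have "\<psi> ((1 - r / (2 * B)) *\<^sub>R 0 + (r / (2 * B)) *\<^sub>R (2 * B)) \<le> (1 - r / (2 * B)) * \<psi> 0 + r / (2 * B) * \<psi> (2 * B)"
      by (rule convex_onD) (use r pos in auto)
    moreover have "\<psi> 0 = 0"
      using AB by (simp add: \<psi>_def flip: distrib_right)
    moreover have "\<psi> (2 * B) \<le> 0"
    proof -
      have "exp (A - B - 1) - exp (- 1 - (A - B)) \<le> A * (exp 0 - exp (- (A - B + (A - B)) / A))"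
        using small[of "A - B"] AB by simp
      moreover have "- (A - B + (A - B)) / A = 2 * B / A - 2" using pos by (simp add: field_simps)
      moreover have "A - B - 1 = - (2 * B)" "- 1 - (A - B) = 2 * B - 2" using AB by auto
      ultimately show ?thesis using pos AB unfolding \<psi>_def by (simp add: right_diff_distrib)
    qed
    then have "r / (2 * B) * \<psi> (2 * B) \<le> 0" using r pos by (intro mult_nonneg_nonpos) auto
    ultimately have "\<psi> r \<le> 0" using pos by simp
    moreover have "- (A - B + t) / A = r / A - 2" "(A - B - t) / B = r / B - 2"
      using pos by (simp_all add: B r_def field_simps)
    moreover have "- (1 + t) = r - 2" "- (1 - t) = - r" by (auto simp: r_def)
    ultimately show ?thesis using 2 AB t unfolding F_def \<psi>_def
      by (simp only: if_True if_False) (auto simp: not_le)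
  next
    case 3
    have le: "C * exp (- 2 - (t - 1) / C) \<le> C * exp (- 1 - t)" if "0 < C" "C < 1" for C
    proof -
      have "(t - 1) * C \<le> (t - 1) * 1" using that 3 by (intro mult_left_mono) auto
      then have "t - 1 \<le> (t - 1) / C" using that by (simp add: field_simps)
      then show ?thesis using that by simp
    qed
    have "A * exp (- 2 - (t - 1) / A) + B * exp (- 2 - (t - 1) / B) \<le> A * exp (- 1 - t) + B * exp (- 1 - t)"
      using pos by (intro add_mono le)
    also have "\<dots> = exp (- 1 - t)" using AB by (simp flip: distrib_right)
    finally have "A * exp (- 2 - (t - 1) / A) + B * exp (- 2 - (t - 1) / B) \<le> exp (- 1 - t)" .
    moreover have "- (A - B + t) / A = - 2 - (t - 1) / A" "(A - B - t) / B = - 2 - (t - 1) / B"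
      using pos by (simp_all add: B field_simps)
    moreover have "\<not> 0 \<le> A - B - t" "0 \<le> A - B + t" using 3 AB by auto
    ultimately show ?thesis using 3 AB t unfolding F_def by simp
  qed
qed (use AB in \<open>simp add: F_def\<close>)

lemma cdf_abs_deviation:
  assumes M: "real_distribution M" and atom: "\<And>a. measure M {a} = 0"
  shows "cdf (distr M borel (\<lambda>x. \<bar>x - c\<bar>)) t = (if t < 0 then 0 else cdf M (c + t) - cdf M (c - t))"
proof -
  interpret real_distribution M by fact
  have "(\<lambda>x. \<bar>x - c\<bar>) -` {..t} = (if t < 0 then {} else {c - t..c + t})" by auto
  then show ?thesis
    by (simp add: cdf_def[of "distr M borel (\<lambda>x. \<bar>x - c\<bar>)"] measure_distr measure_atLeastAtMost_cdf atom)
qed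

text \<open>By reflection it suffices to treat \<open>B \<le> A\<close>, where the distance to the mean is stochastically
dominated by that of a standard exponential variable, \<open>two_sided_exp 1 0\<close>.\<close>

lemma two_sided_exp_deviation_le:
  assumes AB: "0 \<le> A" "0 \<le> B" "A + B = 1" and h: "mono h" "h \<in> borel_measurable borel"
  shows "(\<integral>\<^sup>+y. h \<bar>y - (A - B)\<bar> \<partial>two_sided_exp A B) \<le> (\<integral>\<^sup>+y. h \<bar>y - 1\<bar> \<partial>two_sided_exp 1 0)"
proof -
  note [measurable] = h(2)
  have le: "(\<integral>\<^sup>+y. h \<bar>y - (A - B)\<bar> \<partial>two_sided_exp A B) \<le> (\<integral>\<^sup>+y. h \<bar>y - 1\<bar> \<partial>two_sided_exp 1 0)"
    if AB: "0 \<le> B" "B \<le> A" "A + B = 1" for A B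
  proof -
    have ab: "0 \<le> A" "0 \<le> B" "A + B = 1" and ab1: "0 \<le> (1::real)" "0 \<le> (0::real)" "1 + 0 = (1::real)"
      using AB by auto
    note Y = real_distribution_two_sided_exp[OF ab] and E = real_distribution_two_sided_exp[OF ab1]
    interpret Y: real_distribution "two_sided_exp A B" by fact
    interpret E: real_distribution "two_sided_exp 1 0" by fact
    have atom: "measure (two_sided_exp A B) {a} = 0" for A B a
      unfolding two_sided_exp_def by simp
    have "(\<integral>\<^sup>+y. h y \<partial>distr (two_sided_exp A B) borel (\<lambda>y. \<bar>y - (A - B)\<bar>))
        \<le> (\<integral>\<^sup>+y. h y \<partial>distr (two_sided_exp 1 0) borel (\<lambda>y. \<bar>y - 1\<bar>))"
    proof (rule nn_integral_mono_stochastic_order)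
      fix t
      show "cdf (distr (two_sided_exp 1 0) borel (\<lambda>y. \<bar>y - 1\<bar>)) t
          \<le> cdf (distr (two_sided_exp A B) borel (\<lambda>y. \<bar>y - (A - B)\<bar>)) t"
        unfolding cdf_abs_deviation[OF Y atom] cdf_abs_deviation[OF E atom]
        using two_sided_exp_cdf_central_ge[OF AB, of t]
        by (simp only: cdf_two_sided_exp[OF ab] cdf_two_sided_exp[OF ab1]) simp
    qed (use h in \<open>auto intro!: Y.real_distribution_distr E.real_distribution_distr\<close>)
    then show ?thesis by (simp add: nn_integral_distr)
  qed
  show ?thesis
  proof (cases "B \<le> A")
    case True
    then show ?thesis using AB by (intro le) auto
  next
    case False
    have "(\<integral>\<^sup>+y. h \<bar>y - (A - B)\<bar> \<partial>two_sided_exp A B) = (\<integral>\<^sup>+y. h \<bar>- y - (A - B)\<bar> \<partial>two_sided_exp B A)"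
      using AB by (subst nn_integral_two_sided_exp_reflect) auto
    also have "\<dots> = (\<integral>\<^sup>+y. h \<bar>y - (B - A)\<bar> \<partial>two_sided_exp B A)"
      by (intro nn_integral_cong arg_cong[of _ _ h]) auto
    also have "\<dots> \<le> (\<integral>\<^sup>+y. h \<bar>y - 1\<bar> \<partial>two_sided_exp 1 0)"
      using AB False by (intro le) auto
    finally show ?thesis .
  qed
qed

lemma set_integrable_powr_exp:
  assumes "0 < p"
  shows "set_integrable lborel {0..1} (\<lambda>x. (1 - x) powr p * exp (- x) :: real)"
proof -
  have c: "continuous_on {0..1} (\<lambda>x. (1 - x) powr p :: real)"
    using assms by (intro continuous_on_powr' continuous_intros) auto
  show ?thesis
    by (intro borel_integrable_atLeastAtMost' continuous_on_mult[OF c] continuous_intros)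
qed

text \<open>The part of the integral beyond \<open>1\<close> becomes \<open>exp (- 1)\<close> times the Gamma integral after the
substitution \<open>x = 1 + t\<close>.\<close>

lemma nn_integral_exponential_central_moment:
  assumes p: "0 < p"
  shows "(\<integral>\<^sup>+x. ennreal (\<bar>x - 1\<bar> powr p) \<partial>density lborel (exponential_density 1))
    = ennreal (Gamma (1 + p) / exp 1 + (LBINT x:{0..1}. (1 - x) powr p * exp (- x)))"
proof -
  have "(\<integral>\<^sup>+x. ennreal (\<bar>x - 1\<bar> powr p) \<partial>density lborel (exponential_density 1))
      = (\<integral>\<^sup>+x. ennreal (indicator {0..1} x * ((1 - x) powr p * exp (- x)))
          + ennreal (indicator {1..} x * ((x - 1) powr p * exp (- x))) \<partial>lborel)"
    by (subst nn_integral_density)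
      (use p in \<open>auto simp: exponential_density_def indicator_def abs_if mult.commute simp flip: ennreal_mult'
        intro!: nn_integral_cong\<close>)
  also have "\<dots> = (\<integral>\<^sup>+x. ennreal (indicator {0..1} x * ((1 - x) powr p * exp (- x))) \<partial>lborel)
      + (\<integral>\<^sup>+x. ennreal (indicator {1..} x * ((x - 1) powr p * exp (- x))) \<partial>lborel)"
    by (rule nn_integral_add) auto
  also have "(\<integral>\<^sup>+x. ennreal (indicator {0..1} x * ((1 - x) powr p * exp (- x))) \<partial>lborel)
      = ennreal (LBINT x:{0..1}. (1 - x) powr p * exp (- x))"
    using set_integrable_powr_exp[OF p] unfolding set_lebesgue_integral_def set_integrable_def
    by (subst nn_integral_eq_integral) (auto simp: indicator_def)
  also have "(\<integral>\<^sup>+x. ennreal (indicator {1..} x * ((x - 1) powr p * exp (- x))) \<partial>lborel)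
      = (\<integral>\<^sup>+x. ennreal (exp (- 1)) * ennreal (indicator {0..} x * x powr (1 + p - 1) / exp x) \<partial>lborel)"
    by (subst nn_integral_real_affine[where c = 1 and t = 1])
      (auto simp: indicator_def exp_diff exp_minus field_simps simp flip: ennreal_mult' intro!: nn_integral_cong)
  also have "\<dots> = ennreal (exp (- 1)) * ennreal (Gamma (1 + p))"
    using p by (subst nn_integral_cmult) (auto simp: Gamma_conv_nn_integral_real)
  also have "\<dots> = ennreal (Gamma (1 + p) / exp 1)"
    by (simp add: exp_minus divide_inverse mult.commute flip: ennreal_mult')
  finally show ?thesis
    using p by (subst ennreal_plus) (auto simp: add.commute set_lebesgue_integral_def intro!: integral_nonneg_AE AE_I2 Gamma_real_nonneg)
qed

text \<open>The convexity of \<open>x powr p\<close> on the open half-line settles the case of nonzero \<open>x\<close> and \<open>y\<close>. If one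
of them is \<open>0\<close>, the inequality is \<open>s powr p \<le> s\<close> for a number \<open>s\<close> between \<open>0\<close> and \<open>1\<close>.\<close>

lemma convex_on_abs_powr:
  fixes p :: real
  assumes "1 \<le> p"
  shows "convex_on UNIV (\<lambda>x. \<bar>x\<bar> powr p)"
proof (rule convex_onI)
  fix s x y :: real assume s: "0 < s" "s < 1"
  have pow: "r powr p \<le> r" if "0 < r" "r < 1" for r :: real
    using that assms powr_mono'[of 1 p r] by simp
  have "\<bar>(1 - s) *\<^sub>R x + s *\<^sub>R y\<bar> \<le> (1 - s) * \<bar>x\<bar> + s * \<bar>y\<bar>"
    using s abs_triangle_ineq[of "(1 - s) * x" "s * y"] by (simp add: abs_mult)
  then have "\<bar>(1 - s) *\<^sub>R x + s *\<^sub>R y\<bar> powr p \<le> ((1 - s) * \<bar>x\<bar> + s * \<bar>y\<bar>) powr p"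
    using assms by (intro powr_mono2) auto
  also have "\<dots> \<le> (1 - s) * \<bar>x\<bar> powr p + s * \<bar>y\<bar> powr p"
  proof (cases "x = 0 \<or> y = 0")
    case True
    then show ?thesis
      using pow[of s] pow[of "1 - s"] s assms by (auto simp: powr_mult mult_right_mono)
  next
    case False
    then show ?thesis
      using convex_onD[OF powr_convex[OF assms], of s "\<bar>x\<bar>" "\<bar>y\<bar>"] s by simp
  qed
  finally show "\<bar>(1 - s) *\<^sub>R x + s *\<^sub>R y\<bar> powr p \<le> (1 - s) * \<bar>x\<bar> powr p + s * \<bar>y\<bar> powr p" .
qed simp

section \<open>Central moments of log-concave random variables\<close>

lemma log_concave_central_moment_le:
  assumes g: "log_concave_fun g" and P: "real_distribution (density lborel g)" and g0: "1 \<le> g 0"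
    and p: "1 \<le> p"
  shows "(\<integral>\<^sup>+x. ennreal (\<bar>x - (\<integral>x. x \<partial>density lborel g)\<bar> powr p) \<partial>density lborel g)
    \<le> ennreal (Gamma (1 + p) / exp 1 + (LBINT x:{0..1}. (1 - x) powr p * exp (- x)))"
proof -
  interpret P: real_distribution "density lborel g" by fact
  define A B where AB: "A = measure (density lborel g) {0<..}" "B = measure (density lborel g) {..0}"
  have "A = 1 - B" using P.measure_greaterThan_cdf[of 0] AB by (simp add: cdf_def)
  then have ab: "0 \<le> A" "0 \<le> B" "A + B = 1" using AB by auto
  let ?h = "\<lambda>x. ennreal (max 0 x powr p)"
  have h: "mono ?h" using p by (intro monoI ennreal_leI powr_mono2) auto
  have "(\<integral>\<^sup>+x. ennreal (\<bar>x - (\<integral>x. x \<partial>density lborel g)\<bar> powr p) \<partial>density lborel g)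
      \<le> (\<integral>\<^sup>+y. ennreal (\<bar>y - (A - B)\<bar> powr p) \<partial>two_sided_exp A B)"
    by (rule convex_order_two_sided_exp[OF g P g0 AB convex_on_abs_powr[OF p]]) simp
  also have "\<dots> \<le> (\<integral>\<^sup>+y. ennreal (\<bar>y - 1\<bar> powr p) \<partial>two_sided_exp 1 0)"
    using two_sided_exp_deviation_le[OF ab h] by simp
  also have "\<dots> = (\<integral>\<^sup>+x. ennreal (\<bar>x - 1\<bar> powr p) \<partial>density lborel (exponential_density 1))"
    by (subst nn_integral_two_sided_exp) auto
  also have "\<dots> = ennreal (Gamma (1 + p) / exp 1 + (LBINT x:{0..1}. (1 - x) powr p * exp (- x)))"
    using p by (intro nn_integral_exponential_central_moment) auto
  finally show ?thesis .
qed

text \<open>The variable \<open>?Z = K * (X - m)\<close> has the density \<open>h\<close>, which is log-concave with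
\<open>h 0 = 1\<close>. Its \<open>p\<close>-th central moment is that of \<open>X\<close> times \<open>K powr p\<close>, and
\<open>K\<close> is an upper bound for the density of \<open>X\<close>.\<close>

lemma log_concave_rv_central_moment:
  assumes M: "prob_space M" and X: "log_concave_rv M X"
  shows "integrable M X" "max_density M X \<noteq> \<infinity>"
    "1 \<le> p \<Longrightarrow> ennreal_powr (max_density M X) p * central_abs_moment M p X
      \<le> ennreal (Gamma (1 + p) / exp 1 + (LBINT x:{0..1}. (1 - x) powr p * exp (- x)))"
proof -
  interpret prob_space M by fact
  from X obtain f g where f: "distributed M lborel X f" and g: "log_concave_fun g"
    and fg: "AE x in lborel. f x = ennreal (g x)"
    by (auto simp: log_concave_rv_def)
  have [measurable]: "X \<in> borel_measurable M" and [measurable]: "f \<in> borel_measurable borel"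
    using f by (auto simp: distributed_def)
  have "(\<integral>\<^sup>+x. ennreal (g x) \<partial>lborel) = (\<integral>\<^sup>+x. f x \<partial>lborel)"
    using fg by (intro nn_integral_cong_AE) auto
  also have "\<dots> = 1"
    using distributed_nn_integral[OF f, of "\<lambda>_. 1"] by (simp add: emeasure_space_1)
  finally obtain m K where K: "0 < K" and G: "log_concave_fun (g(m := K))" and le: "\<And>x. (g(m := K)) x \<le> K"
    using log_concave_fun_attains_max[OF g] by metis
  define G where "G = g(m := K)"
  have G: "log_concave_fun G" "\<And>x. G x \<le> K" "G m = K" using G le by (simp_all add: G_def)
  have [measurable]: "G \<in> borel_measurable borel" by (rule log_concave_fun_measurable[OF G(1)])
  have fG: "AE x in lborel. f x = ennreal (G x)"
    using fg AE_lborel_singleton[of m] by eventually_elim (simp add: G_def)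
  have "AE x in lborel. f x \<le> ennreal K"
    using fG by eventually_elim (simp add: G ennreal_leI)
  then have maxK: "max_density M X \<le> ennreal K"
    unfolding max_density_eq[OF f] by (intro esssup_I) auto
  then show "max_density M X \<noteq> \<infinity>" by (auto simp: top_unique)
  have distr: "distr M borel X = density lborel (\<lambda>x. ennreal (G x))"
  proof -
    have "distr M borel X = distr M lborel X" by (simp cong: distr_cong)
    also have "\<dots> = density lborel f" using f by (simp add: distributed_def)
    also have "\<dots> = density lborel (\<lambda>x. ennreal (G x))" using fG by (intro density_cong) auto
    finally show ?thesis .
  qed
  define h where "h x = G ((x - - (K * m)) / K) / \<bar>K\<bar>" for x
  let ?Z = "\<lambda>\<omega>. - (K * m) + K * X \<omega>"
  let ?P = "density lborel (\<lambda>x. ennreal (h x))"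
  have Z: "?P = distr M borel ?Z"
    unfolding h_def using K
    by (subst distr_density_lborel_affine[symmetric])
      (auto simp: distr_distr o_def simp flip: distr)
  have "h = (\<lambda>x. inverse K * G (m + inverse K * x))"
    using K by (auto simp: h_def fun_eq_iff field_simps)
  then have h: "log_concave_fun h" "h 0 = 1"
    using K G by (auto intro!: log_concave_fun_cmult log_concave_fun_affine)
  have P: "real_distribution ?P" unfolding Z by (rule real_distribution_distr) simp
  have "integrable M ?Z"
  proof -
    have "integrable ?P (\<lambda>x. x)" using integrable_log_concave[OF h(1) P] h(2) by simp
    then show ?thesis unfolding Z by (subst (asm) integrable_distr_eq) auto
  qed
  then have "integrable M (\<lambda>\<omega>. K * m + ?Z \<omega>)"
    by (rule Bochner_Integration.integrable_add[OF integrable_const])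
  then have "integrable M (\<lambda>\<omega>. inverse K * (K * m + ?Z \<omega>))"
    by (rule integrable_mult_right)
  moreover have "(\<lambda>\<omega>. inverse K * (K * m + ?Z \<omega>)) = X"
    using K by (auto simp: fun_eq_iff field_simps)
  ultimately show int: "integrable M X" by (simp only:)
  assume p: "1 \<le> p"
  have mean: "(\<integral>x. x \<partial>?P) = - (K * m) + K * expectation X"
  proof -
    have "(\<integral>x. x \<partial>?P) = expectation ?Z" unfolding Z by (rule integral_distr) auto
    also have "\<dots> = - (K * m) + K * expectation X" using int by (simp add: prob_space)
    finally show ?thesis .
  qed
  have "ennreal_powr (max_density M X) p \<le> ennreal (K powr p)"
    using maxK K p unfolding ennreal_powr_def
    by (cases "max_density M X") (auto simp: top_unique ennreal_le_iff2 intro!: ennreal_leI powr_mono2)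
  then have "ennreal_powr (max_density M X) p * central_abs_moment M p X
      \<le> ennreal (K powr p) * central_abs_moment M p X"
    by (rule mult_right_mono) simp
  also have "\<dots> = (\<integral>\<^sup>+\<omega>. ennreal (\<bar>?Z \<omega> - (\<integral>x. x \<partial>?P)\<bar> powr p) \<partial>M)"
  proof -
    have "ennreal (\<bar>?Z \<omega> - (\<integral>x. x \<partial>?P)\<bar> powr p) = ennreal (K powr p) * ennreal (\<bar>X \<omega> - expectation X\<bar> powr p)" for \<omega>
    proof -
      have "\<bar>?Z \<omega> - (\<integral>x. x \<partial>?P)\<bar> = K * \<bar>X \<omega> - expectation X\<bar>"
        using K unfolding mean by (simp add: abs_mult flip: right_diff_distrib)
      then show ?thesis using K by (simp add: powr_mult ennreal_mult')
    qed
    then show ?thesis unfolding central_abs_moment_def by (subst nn_integral_cmult[symmetric]) auto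
  qed
  also have "\<dots> = (\<integral>\<^sup>+x. ennreal (\<bar>x - (\<integral>x. x \<partial>?P)\<bar> powr p) \<partial>distr M borel ?Z)"
    by (subst nn_integral_distr) auto
  also have "\<dots> = (\<integral>\<^sup>+x. ennreal (\<bar>x - (\<integral>x. x \<partial>?P)\<bar> powr p) \<partial>?P)"
    by (simp only: Z)
  also have "\<dots> \<le> ennreal (Gamma (1 + p) / exp 1 + (LBINT x:{0..1}. (1 - x) powr p * exp (- x)))"
    using h p by (intro log_concave_central_moment_le[OF _ P]) auto
  finally show "ennreal_powr (max_density M X) p * central_abs_moment M p X
      \<le> ennreal (Gamma (1 + p) / exp 1 + (LBINT x:{0..1}. (1 - x) powr p * exp (- x)))" .
qed

section \<open>Central moments of random variables with bounded density\<close>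

lemma nn_integral_abs_powr_interval:
  fixes p a c :: real
  assumes p: "0 \<le> p" and a: "0 \<le> a"
  shows "(\<integral>\<^sup>+x. ennreal (\<bar>x - c\<bar> powr p) * indicator {c - a..c + a} x \<partial>lborel)
    = ennreal (2 * a powr (p + 1) / (p + 1))"
proof -
  let ?J = "\<integral>\<^sup>+x. ennreal (\<bar>x\<bar> powr p) * indicator {0..a} x \<partial>lborel"
  have "?J = (\<integral>\<^sup>+x. ennreal (indicator {0..a} x * x powr p) \<partial>lborel)"
    by (intro nn_integral_cong) (auto simp: indicator_def)
  also have "\<dots> = ennreal (a powr (p + 1) / (p + 1))"
    using p a by (intro nn_integral_has_integral_lebesgue has_integral_powr_from_0) auto
  finally have J: "?J = ennreal (a powr (p + 1) / (p + 1))" .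
  have "(\<integral>\<^sup>+x. ennreal (\<bar>x - c\<bar> powr p) * indicator {c - a..c + a} x \<partial>lborel)
      = (\<integral>\<^sup>+x. ennreal (\<bar>x\<bar> powr p) * indicator {- a..a} x \<partial>lborel)"
    by (subst nn_integral_real_affine[where c = 1 and t = c])
      (auto simp: indicator_def intro!: nn_integral_cong)
  also have "\<dots> = (\<integral>\<^sup>+x. ennreal (\<bar>x\<bar> powr p) * indicator {0..a} x
      + ennreal (\<bar>- x\<bar> powr p) * indicator {0..a} (- x) \<partial>lborel)"
    using AE_lborel_singleton[of 0] a
    by (intro nn_integral_cong_AE) (auto elim!: eventually_mono simp: indicator_def)
  also have "\<dots> = ?J + (\<integral>\<^sup>+x. ennreal (\<bar>- x\<bar> powr p) * indicator {0..a} (- x) \<partial>lborel)"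
    by (rule nn_integral_add) auto
  also have "(\<integral>\<^sup>+x. ennreal (\<bar>- x\<bar> powr p) * indicator {0..a} (- x) \<partial>lborel) = ?J"
    by (subst nn_integral_real_affine[where c = "-1" and t = 0]) auto
  finally show ?thesis unfolding J using p by (simp flip: ennreal_plus)
qed

text \<open>Let \<open>d\<close> bound the density \<open>f\<close>, and let \<open>a = 1 / (2 * d)\<close>, so that the density which
is \<open>d\<close> on \<open>[c - a, c + a]\<close> and \<open>0\<close> elsewhere has mass \<open>1\<close>. Passing from it to \<open>f\<close> moves mass from
points where \<open>\<bar>x - c\<bar> powr p\<close> is at most \<open>a powr p\<close> to points where it is at least
\<open>a powr p\<close>. If the density is unbounded, the product is infinite, as the central moment of an
absolutely continuous variable is positive.\<close>

lemma central_moment_max_density_ge: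
  assumes M: "prob_space M" and f: "distributed M lborel X f" and p: "1 \<le> p"
  shows "ennreal (1 / (2 powr p * (p + 1))) \<le> ennreal_powr (max_density M X) p * central_abs_moment M p X"
proof -
  interpret prob_space M by fact
  have [measurable]: "X \<in> borel_measurable M" and [measurable]: "f \<in> borel_measurable borel"
    using f by (auto simp: distributed_def)
  define c where "c = expectation X"
  have f1: "(\<integral>\<^sup>+x. f x \<partial>lborel) = 1"
    using distributed_nn_integral[OF f, of "\<lambda>_. 1"] by (simp add: emeasure_space_1)
  have \<sigma>: "central_abs_moment M p X = (\<integral>\<^sup>+x. f x * ennreal (\<bar>x - c\<bar> powr p) \<partial>lborel)"
    unfolding central_abs_moment_def c_def by (subst distributed_nn_integral[OF f]) auto
  show ?thesis
  proof (cases "max_density M X")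
    case top
    have "central_abs_moment M p X \<noteq> 0"
    proof
      assume "central_abs_moment M p X = 0"
      then have "AE x in lborel. f x * ennreal (\<bar>x - c\<bar> powr p) = 0"
        unfolding \<sigma> by (subst (asm) nn_integral_0_iff_AE) auto
      then have "AE x in lborel. f x = 0"
        using AE_lborel_singleton[of c] by eventually_elim simp
      then have "(\<integral>\<^sup>+x. f x \<partial>lborel) = (\<integral>\<^sup>+x. 0 \<partial>(lborel::real measure))"
        by (rule nn_integral_cong_AE)
      with f1 show False by simp
    qed
    then show ?thesis using top by (simp add: ennreal_powr_def ennreal_top_mult)
  next
    case (real d)
    have fd: "AE x in lborel. f x \<le> ennreal d"
      using esssup_AE[of f lborel] real unfolding max_density_eq[OF f] by simp
    have "0 < d"
    proof (rule ccontr)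
      assume "\<not> 0 < d"
      with real have "d = 0" by simp
      then have "(\<integral>\<^sup>+x. f x \<partial>lborel) = (\<integral>\<^sup>+x. 0 \<partial>(lborel::real measure))"
        using fd by (intro nn_integral_cong_AE) auto
      with f1 show False by simp
    qed
    define a where "a = 1 / (2 * d)"
    have "0 < a" using \<open>0 < d\<close> by (simp add: a_def)
    let ?I = "indicator {c - a..c + a} :: real \<Rightarrow> ennreal"
    let ?q = "ennreal (a powr p)"
    let ?u = "\<lambda>x. ennreal (\<bar>x - c\<bar> powr p)"
    \<comment> \<open>Inside the interval this is \<open>0 \<le> (a powr p - u) * (d - f x)\<close>, with \<open>u = \<bar>x - c\<bar> powr p\<close>; outside, \<open>a powr p \<le> u\<close> suffices.\<close>
    have "(\<integral>\<^sup>+x. ?q * f x + ennreal d * (?u x * ?I x) \<partial>lborel)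
        \<le> (\<integral>\<^sup>+x. f x * ?u x + ennreal (a powr p * d) * ?I x \<partial>lborel)"
    proof (rule nn_integral_mono_AE)
      show "AE x in lborel. ?q * f x + ennreal d * (?u x * ?I x) \<le> f x * ?u x + ennreal (a powr p * d) * ?I x"
        using fd
      proof eventually_elim
        case (elim x)
        then obtain r where r: "f x = ennreal r" "0 \<le> r" "r \<le> d"
          using \<open>0 < d\<close> by (cases "f x") (auto simp: top_unique)
        show ?case
        proof (cases "x \<in> {c - a..c + a}")
          case True
          then have "\<bar>x - c\<bar> powr p \<le> a powr p" using p by (intro powr_mono2) auto
          then have "0 \<le> (a powr p - \<bar>x - c\<bar> powr p) * (d - r)" using r by simp
          then have "a powr p * r + d * (\<bar>x - c\<bar> powr p) \<le> r * (\<bar>x - c\<bar> powr p) + a powr p * d"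
            by (simp add: algebra_simps)
          with True r \<open>0 < d\<close> show ?thesis
            by (simp add: ennreal_leI flip: ennreal_mult' ennreal_plus)
        next
          case False
          then have "a powr p \<le> \<bar>x - c\<bar> powr p" using p \<open>0 < a\<close> by (intro powr_mono2) auto
          then have "a powr p * r \<le> r * (\<bar>x - c\<bar> powr p)" using r by (simp add: mult.commute mult_left_mono)
          with False r show ?thesis by (simp add: ennreal_leI flip: ennreal_mult')
        qed
      qed
    qed
    also have "(\<integral>\<^sup>+x. ?q * f x + ennreal d * (?u x * ?I x) \<partial>lborel)
        = ?q + ennreal (d * (2 * a powr (p + 1) / (p + 1)))"
      using p \<open>0 < a\<close> \<open>0 < d\<close>
      by (simp add: nn_integral_add nn_integral_cmult f1 nn_integral_abs_powr_interval flip: ennreal_mult')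
    also have "(\<integral>\<^sup>+x. f x * ?u x + ennreal (a powr p * d) * ?I x \<partial>lborel) = central_abs_moment M p X + ?q"
    proof -
      have "ennreal (a powr p * d) * ennreal (2 * a) = ?q"
        using \<open>0 < d\<close> \<open>0 < a\<close> by (simp add: a_def flip: ennreal_mult')
      then show ?thesis
        using \<open>0 < a\<close> by (simp add: nn_integral_add nn_integral_cmult nn_integral_cmult_indicator \<sigma>)
    qed
    finally have "?q + ennreal (d * (2 * a powr (p + 1) / (p + 1))) \<le> ?q + central_abs_moment M p X"
      by (simp add: add.commute)
    then have le: "ennreal (d * (2 * a powr (p + 1) / (p + 1))) \<le> central_abs_moment M p X"
      by (simp add: ennreal_add_left_cancel_le)
    have "1 / (2 powr p * (p + 1)) = d powr p * (d * (2 * a powr (p + 1) / (p + 1)))"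
    proof -
      have "d powr p * a powr p = (1 / 2) powr p"
        using \<open>0 < d\<close> by (simp add: a_def flip: powr_mult)
      moreover have "a powr (p + 1) = a powr p * a" using \<open>0 < a\<close> by (simp add: powr_add)
      moreover have "d * (2 * a) = 1" using \<open>0 < d\<close> by (simp add: a_def)
      ultimately have "d powr p * (d * (2 * a powr (p + 1) / (p + 1))) = (1 / 2) powr p / (p + 1)"
        by (metis (no_types, lifting) mult.assoc mult.commute mult.right_neutral times_divide_eq_right)
      then show ?thesis by (simp add: powr_divide)
    qed
    then have "ennreal (1 / (2 powr p * (p + 1))) = ennreal (d powr p) * ennreal (d * (2 * a powr (p + 1) / (p + 1)))"
      by (subst ennreal_mult'[symmetric]) simp_all
    also have "\<dots> \<le> ennreal (d powr p) * central_abs_moment M p X"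
      by (intro mult_left_mono le) simp
    also have "ennreal (d powr p) = ennreal_powr (max_density M X) p"
      using real by (simp add: ennreal_powr_def)
    finally show ?thesis .
  qed
qed

section \<open>Uniform and exponential variables, and subfactorials\<close>

lemma max_density_geI:
  assumes f: "distributed M lborel X f" and "a < b"
    and k: "\<And>x. a < x \<Longrightarrow> x < b \<Longrightarrow> k \<le> f x"
  shows "k \<le> max_density M X"
proof (rule ccontr)
  assume "\<not> ?thesis"
  then have less: "esssup lborel f < k" by (simp add: max_density_eq[OF f])
  have "AE x in lborel. x \<notin> {a<..<b}"
    using esssup_AE[of f lborel]
  proof eventually_elim
    case (elim x)
    then show ?case using k[of x] less by auto
  qed
  then have "emeasure lborel {a<..<b} = 0"
    by (subst (asm) AE_iff_measurable[of "{a<..<b}"]) auto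
  with \<open>a < b\<close> show False by simp
qed

lemma max_density_leI:
  assumes f: "distributed M lborel X f" and "\<And>x. f x \<le> k"
  shows "max_density M X \<le> k"
proof -
  have [measurable]: "f \<in> borel_measurable borel" using f by (auto simp: distributed_def)
  show ?thesis unfolding max_density_eq[OF f] using assms by (intro esssup_I) auto
qed

lemma central_moment_uniform:
  assumes M: "prob_space M" and "a < b" and p: "0 \<le> p"
    and X: "distributed M lborel X (\<lambda>x. ennreal (indicator {a..b} x / (b - a)))"
  shows "central_abs_moment M p X = ennreal (((b - a) / 2) powr p / (p + 1))"
proof -
  interpret prob_space M by fact
  define r where "r = (b - a) / 2"
  have r: "0 < r" "a = (a + b) / 2 - r" "b = (a + b) / 2 + r" using \<open>a < b\<close> by (auto simp: r_def field_simps)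
  have mean: "expectation X = (a + b) / 2"
    using X \<open>a < b\<close> by (intro uniform_distributed_expectation) simp
  have "central_abs_moment M p X
      = (\<integral>\<^sup>+x. ennreal (indicator {a..b} x / (b - a)) * ennreal (\<bar>x - (a + b) / 2\<bar> powr p) \<partial>lborel)"
    unfolding central_abs_moment_def mean by (subst distributed_nn_integral[OF X]) auto
  also have "\<dots> = (\<integral>\<^sup>+x. ennreal (1 / (b - a)) * (ennreal (\<bar>x - (a + b) / 2\<bar> powr p) * indicator {(a + b) / 2 - r..(a + b) / 2 + r} x) \<partial>lborel)"
    using \<open>a < b\<close> r by (intro nn_integral_cong) (auto simp: indicator_def)
  also have "\<dots> = ennreal (1 / (b - a)) * ennreal (2 * r powr (p + 1) / (p + 1))"
    using p r(1) by (subst nn_integral_cmult) (simp_all add: nn_integral_abs_powr_interval)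
  also have "\<dots> = ennreal (1 / (b - a) * (2 * r powr (p + 1) / (p + 1)))"
    using \<open>a < b\<close> by (subst ennreal_mult'[symmetric]) auto
  also have "1 / (b - a) * (2 * r powr (p + 1) / (p + 1)) = r powr p / (p + 1)"
  proof -
    have "b - a = 2 * r" by (simp add: r_def)
    then show ?thesis using r(1) by (simp only: powr_add) simp
  qed
  finally show ?thesis by (simp add: r_def)
qed

lemma max_density_uniform:
  assumes "a < b" and X: "distributed M lborel X (\<lambda>x. ennreal (indicator {a..b} x / (b - a)))"
  shows "max_density M X = ennreal (1 / (b - a))"
proof (rule antisym)
  show "max_density M X \<le> ennreal (1 / (b - a))"
    using \<open>a < b\<close> by (intro max_density_leI[OF X] ennreal_leI) (auto simp: indicator_def)
  show "ennreal (1 / (b - a)) \<le> max_density M X"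
    using \<open>a < b\<close> by (intro max_density_geI[OF X \<open>a < b\<close>]) (auto simp: indicator_def)
qed

lemma central_moment_exponential:
  assumes M: "prob_space M" and l: "0 < l" and p: "0 < p"
    and X: "distributed M lborel X (\<lambda>x. ennreal (exponential_density l x))"
  shows "central_abs_moment M p X
    = ennreal (l powr (- p) * (Gamma (1 + p) / exp 1 + (LBINT x:{0..1}. (1 - x) powr p * exp (- x))))"
proof -
  interpret prob_space M by fact
  have "expectation X = 1 / l" using exponential_distributed_expectation[OF l X] .
  then have "central_abs_moment M p X
      = (\<integral>\<^sup>+x. ennreal (exponential_density l x) * ennreal (\<bar>x - 1 / l\<bar> powr p) \<partial>lborel)"
    unfolding central_abs_moment_def by (subst distributed_nn_integral[OF X]) auto
  also have "\<dots> = ennreal \<bar>1 / l\<bar> * (\<integral>\<^sup>+x. ennreal (exponential_density l (0 + 1 / l * x)) * ennreal (\<bar>0 + 1 / l * x - 1 / l\<bar> powr p) \<partial>lborel)"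
    using l by (intro nn_integral_real_affine) auto
  also have "\<dots> = (\<integral>\<^sup>+x. ennreal (l powr (- p)) * (ennreal (exponential_density 1 x) * ennreal (\<bar>x - 1\<bar> powr p)) \<partial>lborel)"
  proof (subst nn_integral_cmult[symmetric])
    show "(\<integral>\<^sup>+x. ennreal \<bar>1 / l\<bar> * (ennreal (exponential_density l (0 + 1 / l * x)) * ennreal (\<bar>0 + 1 / l * x - 1 / l\<bar> powr p)) \<partial>lborel)
      = (\<integral>\<^sup>+x. ennreal (l powr (- p)) * (ennreal (exponential_density 1 x) * ennreal (\<bar>x - 1\<bar> powr p)) \<partial>lborel)"
    proof (rule nn_integral_cong)
      fix x :: real
      have dens: "\<bar>1 / l\<bar> * exponential_density l (0 + 1 / l * x) = exponential_density 1 x"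
        using l by (simp add: exponential_density_def divide_less_0_iff)
      have dev: "\<bar>0 + 1 / l * x - 1 / l\<bar> powr p = l powr (- p) * \<bar>x - 1\<bar> powr p"
      proof -
        have "0 + 1 / l * x - 1 / l = (x - 1) / l" by (simp add: diff_divide_distrib)
        moreover have "\<bar>(x - 1) / l\<bar> powr p = \<bar>x - 1\<bar> powr p / l powr p"
          using l by (simp add: abs_divide powr_divide)
        ultimately show ?thesis by (simp only:) (simp add: powr_minus divide_inverse mult.commute)
      qed
      have "ennreal \<bar>1 / l\<bar> * (ennreal (exponential_density l (0 + 1 / l * x)) * ennreal (\<bar>0 + 1 / l * x - 1 / l\<bar> powr p))
          = ennreal (\<bar>1 / l\<bar> * exponential_density l (0 + 1 / l * x)) * ennreal (\<bar>0 + 1 / l * x - 1 / l\<bar> powr p)"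
        by (simp only: ennreal_mult'[OF abs_ge_zero] mult.assoc)
      also have "\<dots> = ennreal (exponential_density 1 x) * (ennreal (l powr (- p)) * ennreal (\<bar>x - 1\<bar> powr p))"
        by (simp only: dens dev ennreal_mult'[OF powr_ge_zero])
      finally show "ennreal \<bar>1 / l\<bar> * (ennreal (exponential_density l (0 + 1 / l * x)) * ennreal (\<bar>0 + 1 / l * x - 1 / l\<bar> powr p))
          = ennreal (l powr (- p)) * (ennreal (exponential_density 1 x) * ennreal (\<bar>x - 1\<bar> powr p))"
        by (simp only: mult.left_commute)
    qed
  qed auto
  also have "\<dots> = ennreal (l powr (- p)) * (\<integral>\<^sup>+x. ennreal (\<bar>x - 1\<bar> powr p) \<partial>density lborel (exponential_density 1))"
    by (subst nn_integral_cmult) (auto simp: nn_integral_density)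
  also have "\<dots> = ennreal (l powr (- p)) * ennreal (Gamma (1 + p) / exp 1 + (LBINT x:{0..1}. (1 - x) powr p * exp (- x)))"
    by (simp only: nn_integral_exponential_central_moment[OF p])
  finally show ?thesis by (simp add: ennreal_mult')
qed

lemma max_density_exponential:
  assumes l: "0 < l" and X: "distributed M lborel X (\<lambda>x. ennreal (exponential_density l x))"
  shows "max_density M X = ennreal l"
proof (rule antisym)
  show "max_density M X \<le> ennreal l"
    using l by (intro max_density_leI[OF X] ennreal_leI) (auto simp: exponential_density_def)
  have "ennreal (l * exp (- \<epsilon> * l)) \<le> max_density M X" if "0 < \<epsilon>" for \<epsilon>
    using l that
    by (intro max_density_geI[OF X that] ennreal_leI) (auto simp: exponential_density_def)
  moreover have "((\<lambda>\<epsilon>. ennreal (l * exp (- \<epsilon> * l))) \<longlongrightarrow> ennreal (l * exp (- 0 * l))) (at_right 0)"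
    by (intro tendsto_intros)
  ultimately show "ennreal l \<le> max_density M X"
    by (intro tendsto_upperbound[of "\<lambda>\<epsilon>. ennreal (l * exp (- \<epsilon> * l))" _ "at_right 0"])
      (auto simp: eventually_at_right_less intro: eventually_mono[OF eventually_at_right_less])
qed

text \<open>The integral that defines the subfactorial splits at \<open>1\<close>. The part beyond \<open>1\<close> is
\<open>fact n / exp 1\<close>, and the integrand on \<open>[0, 1]\<close> has the sign \<open>(-1) ^ n\<close>. The two
closed intervals share the point \<open>1\<close>, where the integrand vanishes since \<open>n > 0\<close>.\<close>

lemma subfactorial_minus_factorial:
  assumes n: "1 \<le> n"
  shows "(-1) ^ n * (subfactorial n - fact n / exp 1) = (LBINT x:{0..1}. (1 - x) powr real n * exp (- x))"
proof -
  let ?f = "\<lambda>x::real. (x - 1) ^ n * exp (- x)"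
  have "(\<integral>\<^sup>+x. ennreal (indicator {1..} x * ?f x) \<partial>lborel)
      = (\<integral>\<^sup>+x. ennreal (exp (- 1)) * (ennreal (x ^ n * exp (- x)) * indicator {0..} x) \<partial>lborel)"
    by (subst nn_integral_real_affine[where c = 1 and t = 1])
      (auto simp: indicator_def mult_ac simp flip: ennreal_mult' exp_add intro!: nn_integral_cong)
  also have "\<dots> = ennreal (exp (- 1)) * ennreal (fact n)"
    by (subst nn_integral_cmult) (auto simp: nn_intergal_power_times_exp_Ici)
  also have "\<dots> = ennreal (fact n / exp 1)"
    by (simp add: exp_minus divide_inverse mult.commute flip: ennreal_mult')
  finally have right: "has_bochner_integral lborel (\<lambda>x. indicator {1..} x * ?f x) (fact n / exp 1)"
    by (intro has_bochner_integral_nn_integral) (auto simp: indicator_def)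
  have left: "integrable lborel (\<lambda>x. indicator {0..1} x * ?f x)"
  proof -
    have "continuous_on {0..1} ?f" by (intro continuous_intros)
    from borel_integrable_atLeastAtMost'[OF this] show ?thesis by (simp add: set_integrable_def)
  qed
  have "subfactorial n = (\<integral>x. indicator {0..1} x * ?f x + indicator {1..} x * ?f x \<partial>lborel)"
    unfolding subfactorial_def set_lebesgue_integral_def
    using n by (intro Bochner_Integration.integral_cong) (auto simp: indicator_def)
  also have "\<dots> = (\<integral>x. indicator {0..1} x * ?f x \<partial>lborel) + fact n / exp 1"
    using right left by (subst Bochner_Integration.integral_add) (auto simp: has_bochner_integral_iff)
  finally have "(-1) ^ n * (subfactorial n - fact n / exp 1) = (\<integral>x. (-1) ^ n * (indicator {0..1} x * ?f x) \<partial>lborel)"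
    by simp
  also have "\<dots> = (LBINT x:{0..1}. (1 - x) powr real n * exp (- x))"
    unfolding set_lebesgue_integral_def
  proof (intro Bochner_Integration.integral_cong refl)
    fix x :: real
    have "(-1) ^ n * (x - 1) ^ n = (1 - x) ^ n"
      by (simp flip: power_mult_distrib)
    moreover have "(1 - x) ^ n = (1 - x) powr real n" if "x \<in> {0..1}"
      using that n by (cases "x = 1") (auto simp: powr_realpow)
    ultimately show "(-1) ^ n * (indicator {0..1} x * ?f x) = indicator {0..1} x *\<^sub>R ((1 - x) powr real n * exp (- x))"
      by (auto simp: indicator_def)
  qed
  finally show ?thesis .
qed

theorem corollary3p9:
  fixes M :: "'a measure" and X :: "'a \<Rightarrow> real" and p :: real
  assumes "prob_space M" and "p \<ge> 1"
  shows
    "(log_concave_rv M X \<longrightarrow>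
        ennreal (1 / (2 powr p * (p + 1)))
          \<le> ennreal_powr (max_density M X) p * central_abs_moment M p X \<and>
        ennreal_powr (max_density M X) p * central_abs_moment M p X
          \<le> ennreal (Gamma (1 + p) / exp 1 + (LBINT x:{0..1}. (1 - x) powr p * exp (- x)))) \<and>
     ((\<exists>f. distributed M lborel X f) \<and> integrable M X \<longrightarrow>
        ennreal (1 / (2 powr p * (p + 1)))
          \<le> ennreal_powr (max_density M X) p * central_abs_moment M p X) \<and>
     (\<forall>a b. a < b \<and> distributed M lborel X (\<lambda>x. ennreal (indicator {a..b} x / (b - a))) \<longrightarrow>
        ennreal_powr (max_density M X) p * central_abs_moment M p X
          = ennreal (1 / (2 powr p * (p + 1)))) \<and>
     (\<forall>l. 0 < l \<and> distributed M lborel X (\<lambda>x. ennreal (exponential_density l x)) \<longrightarrow>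
        ennreal_powr (max_density M X) p * central_abs_moment M p X
          = ennreal (Gamma (1 + p) / exp 1 + (LBINT x:{0..1}. (1 - x) powr p * exp (- x)))) \<and>
     (\<forall>n::nat. 1 \<le> n \<and> log_concave_rv M X \<longrightarrow>
        max_density M X ^ n * central_abs_moment M (real n) X
          \<le> ennreal (fact n / exp 1 + (-1) ^ n * (subfactorial n - fact n / exp 1)))"
proof (intro conjI impI allI; (elim conjE exE)?)
  show "ennreal (1 / (2 powr p * (p + 1))) \<le> ennreal_powr (max_density M X) p * central_abs_moment M p X"
    if "distributed M lborel X f" for f
    using assms that by (intro central_moment_max_density_ge)
  then show "ennreal (1 / (2 powr p * (p + 1))) \<le> ennreal_powr (max_density M X) p * central_abs_moment M p X"
    if "log_concave_rv M X"
    using that by (auto simp: log_concave_rv_def)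
  show "ennreal_powr (max_density M X) p * central_abs_moment M p X
      \<le> ennreal (Gamma (1 + p) / exp 1 + (LBINT x:{0..1}. (1 - x) powr p * exp (- x)))"
    if "log_concave_rv M X"
    using assms that by (intro log_concave_rv_central_moment)
next
  fix a b :: real
  assume "a < b" and X: "distributed M lborel X (\<lambda>x. ennreal (indicator {a..b} x / (b - a)))"
  have "ennreal_powr (max_density M X) p = ennreal ((1 / (b - a)) powr p)"
    using \<open>a < b\<close> by (simp add: max_density_uniform[OF \<open>a < b\<close> X] ennreal_powr_def)
  moreover have "central_abs_moment M p X = ennreal (((b - a) / 2) powr p / (p + 1))"
    using assms \<open>a < b\<close> X by (intro central_moment_uniform) auto
  ultimately have "ennreal_powr (max_density M X) p * central_abs_moment M p X
      = ennreal ((1 / (b - a)) powr p * (((b - a) / 2) powr p / (p + 1)))"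
    by (simp only: ennreal_mult'[OF powr_ge_zero])
  also have "(1 / (b - a)) powr p * (((b - a) / 2) powr p / (p + 1)) = 1 / (2 powr p * (p + 1))"
    using \<open>a < b\<close> by (simp add: powr_divide)
  finally show "ennreal_powr (max_density M X) p * central_abs_moment M p X = ennreal (1 / (2 powr p * (p + 1)))" .
next
  fix l :: real
  assume l: "0 < l" and X: "distributed M lborel X (\<lambda>x. ennreal (exponential_density l x))"
  let ?C = "Gamma (1 + p) / exp 1 + (LBINT x:{0..1}. (1 - x) powr p * exp (- x))"
  have "ennreal_powr (max_density M X) p = ennreal (l powr p)"
    using l by (simp add: max_density_exponential[OF l X] ennreal_powr_def)
  moreover have "central_abs_moment M p X = ennreal (l powr (- p) * ?C)"
    using assms l X by (intro central_moment_exponential) auto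
  ultimately have "ennreal_powr (max_density M X) p * central_abs_moment M p X
      = ennreal (l powr p * (l powr (- p) * ?C))"
    by (simp only: ennreal_mult'[OF powr_ge_zero])
  also have "l powr p * (l powr (- p) * ?C) = ?C"
    using l by (simp add: powr_minus)
  finally show "ennreal_powr (max_density M X) p * central_abs_moment M p X = ennreal ?C" .
next
  fix n :: nat
  assume n: "1 \<le> n" and X: "log_concave_rv M X"
  have "max_density M X ^ n = ennreal_powr (max_density M X) (real n)"
    using log_concave_rv_central_moment(2)[OF assms(1) X] n
    by (cases "max_density M X") (auto simp: ennreal_powr_def ennreal_power powr_realpow')
  moreover have "Gamma (1 + real n) = fact n" by (simp add: Gamma_fact)
  ultimately show "max_density M X ^ n * central_abs_moment M (real n) X
      \<le> ennreal (fact n / exp 1 + (-1) ^ n * (subfactorial n - fact n / exp 1))"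
    using log_concave_rv_central_moment(3)[OF assms(1) X, of "real n"] n by (simp add: subfactorial_minus_factorial)
qed

end
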